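(* For real $\alpha,\beta$ with $\alpha^2+\beta^2=1$ let $$\mathcal{S}_1^{\alpha,\beta}=\{\alpha\cos(x+\mu)+\beta\cos(y+\lambda):(\mu,\lambda)\in\mathbb{R}^2\},$$ regarded as a set of functions of $(x,y)\in\mathbb{T}^2$, and let $$\mathcal{E}=\Big\{(\pm1,0),(0,\pm1),\big(\pm\tfrac{1}{\sqrt2},\pm\tfrac{1}{\sqrt2}\big)\Big\},$$ where all four sign combinations are allowed in the last entry, so that $\mathcal{E}$ consists of eight points of the unit circle. (i) If $(\alpha,\beta)\in\mathcal{E}$, then there exist $C>0$ and $\epsilon_0>0$ (depending on $(\alpha,\beta)$) such that for every $0<\epsilon<\epsilon_0$ and every smooth solution $\omega$ of the 2D Euler equation on $\mathbb{T}^2$ with initial data $\omega_0=\omega(0)$, $$d(\omega_0,\mathcal{S}_1^{\alpha,\beta})<\epsilon\implies d(\omega(t),\mathcal{S}_1^{\alpha,\beta})<C\sqrt{\epsilon}\quad\text{for all }t\in\mathbb{R}.$$ (ii) If $\alpha^2+\beta^2=1$ and $(\alpha,\beta)\notin\mathcal{E}$, then there exist $C>0$ and $\epsilon_0>0$ (depending on $(\alpha,\beta)$) such that for every $0<\epsilon<\epsilon_0$ and every smooth solution $\omega$ of the 2D Euler equation on $\mathbb{T}^2$ with initial data $\omega_0=\omega(0)$, $$d(\omega_0,\mathcal{S}_1^{\alpha,\beta})<\epsilon\implies d(\omega(t),\mathcal{S}_1^{\alpha,\beta})<C\epsilon\quad\text{for all }t\in\mathbb{R}.$$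
   Context: $\mathbb{T}^2=(\mathbb{R}/2\pi\mathbb{Z})^2$ with coordinates $(x,y)$. The 2D Euler equation in vorticity form for a real scalar function $\omega(t,\cdot)$ on $\mathbb{T}^2$ is $$\partial_t\omega+u\cdot\nabla\omega=0,\qquad u=\nabla^\perp(-\Delta)^{-1}\omega,$$ where $\omega(t,\cdot)$ has zero spatial mean, $(-\Delta)^{-1}\omega$ denotes the mean-zero solution $\psi$ of $-\Delta\psi=\omega$ on $\mathbb{T}^2$, and $\nabla^\perp=(-\partial_y,\partial_x)$. Smooth mean-zero initial data give rise to a unique smooth solution for all $t\in\mathbb{R}$. The distance is the $L^2$ distance: for $g\in L^2(\mathbb{T}^2)$ and a set $\mathcal{S}\subset L^2(\mathbb{T}^2)$, $d(g,\mathcal{S})=\inf_{h\in\mathcal{S}}|g-h|_{L^2(\mathbb{T}^2)}$. *)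

theory Defs
  imports "HOL-Analysis.Analysis"
begin

definition pderiv_dir :: "'a::euclidean_space \<Rightarrow> ('a \<Rightarrow> real) \<Rightarrow> 'a \<Rightarrow> real"
  where "pderiv_dir v f z = frechet_derivative f (at z) v"

text \<open>
  Frechet differentiability is asked for explicitly because \<open>frechet_derivative\<close> is an
  unspecified value at points where the function is not differentiable.
\<close>

primrec Ck :: "nat \<Rightarrow> ('a::euclidean_space \<Rightarrow> real) \<Rightarrow> bool" where
  "Ck 0 f \<longleftrightarrow> continuous_on UNIV f"
| "Ck (Suc k) f \<longleftrightarrow> f differentiable_on UNIV \<and> (\<forall>b\<in>Basis. Ck k (pderiv_dir b f))"

definition smooth :: "('a::euclidean_space \<Rightarrow> real) \<Rightarrow> bool"
  where "smooth f \<longleftrightarrow> (\<forall>k. Ck k f)"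

text \<open>
  A function on the torus is represented by its lift to the plane, a function that is
  periodic with period \<open>2 * pi\<close> in each variable.  Integrals over the torus are Lebesgue
  integrals over a fundamental square, with no normalising factor.
\<close>

definition torus_periodic :: "(real \<times> real \<Rightarrow> real) \<Rightarrow> bool"
  where "torus_periodic f \<longleftrightarrow>
    (\<forall>x y. f (x + 2 * pi, y) = f (x, y) \<and> f (x, y + 2 * pi) = f (x, y))"

definition torus_integral :: "(real \<times> real \<Rightarrow> real) \<Rightarrow> real"
  where "torus_integral f = (LINT z : {0..2 * pi} \<times> {0..2 * pi} | lborel. f z)"

definition mean_zero :: "(real \<times> real \<Rightarrow> real) \<Rightarrow> bool"
  where "mean_zero f \<longleftrightarrow> torus_integral f = 0"

definition torus_L2_norm :: "(real \<times> real \<Rightarrow> real) \<Rightarrow> real"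
  where "torus_L2_norm f = sqrt (torus_integral (\<lambda>z. (f z)\<^sup>2))"

definition torus_L2_dist :: "(real \<times> real \<Rightarrow> real) \<Rightarrow> (real \<times> real \<Rightarrow> real) set \<Rightarrow> real"
  where "torus_L2_dist g S = (INF h\<in>S. torus_L2_norm (\<lambda>z. g z - h z))"

definition dx :: "(real \<times> real \<Rightarrow> real) \<Rightarrow> real \<times> real \<Rightarrow> real"
  where "dx = pderiv_dir (1, 0)"

definition dy :: "(real \<times> real \<Rightarrow> real) \<Rightarrow> real \<times> real \<Rightarrow> real"
  where "dy = pderiv_dir (0, 1)"

definition grad :: "(real \<times> real \<Rightarrow> real) \<Rightarrow> real \<times> real \<Rightarrow> real \<times> real"
  where "grad f z = (dx f z, dy f z)"

definition perp_grad :: "(real \<times> real \<Rightarrow> real) \<Rightarrow> real \<times> real \<Rightarrow> real \<times> real"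
  where "perp_grad f z = (- dy f z, dx f z)"

definition laplacian :: "(real \<times> real \<Rightarrow> real) \<Rightarrow> real \<times> real \<Rightarrow> real"
  where "laplacian f z = dx (dx f) z + dy (dy f) z"

text \<open>
  The relation \<open>\<psi> = (-\<Delta>)\<^sup>-\<^sup>1 \<omega>\<close>: the function \<open>\<psi>\<close> is the mean-zero (classical) solution of
  Poisson's equation on the torus.  It is unique, and it is smooth whenever \<open>\<omega>\<close> is, so
  asking only for class \<open>C\<^sup>2\<close> loses nothing.
\<close>

definition inv_neg_laplacian :: "(real \<times> real \<Rightarrow> real) \<Rightarrow> (real \<times> real \<Rightarrow> real) \<Rightarrow> bool"
  where "inv_neg_laplacian \<omega> \<psi> \<longleftrightarrow>
    Ck 2 \<psi> \<and> torus_periodic \<psi> \<and> mean_zero \<psi> \<and> (\<forall>z. - laplacian \<psi> z = \<omega> z)"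

text \<open>
  Solutions are global in time, \<open>t\<close> ranging over all reals, and smooth jointly in
  time and space.
\<close>

definition smooth_euler_solution :: "(real \<Rightarrow> real \<times> real \<Rightarrow> real) \<Rightarrow> bool"
  where "smooth_euler_solution \<omega> \<longleftrightarrow>
    smooth (\<lambda>(t, z). \<omega> t z) \<and>
    (\<forall>t. torus_periodic (\<omega> t) \<and> mean_zero (\<omega> t)) \<and>
    (\<exists>\<psi>. \<forall>t. inv_neg_laplacian (\<omega> t) (\<psi> t) \<and>
      (\<forall>z. deriv (\<lambda>s. \<omega> s z) t + perp_grad (\<psi> t) z \<bullet> grad (\<omega> t) z = 0))"

definition S1 :: "real \<Rightarrow> real \<Rightarrow> (real \<times> real \<Rightarrow> real) set"
  where "S1 \<alpha> \<beta> = {(\<lambda>(x, y). \<alpha> * cos (x + \<mu>) + \<beta> * cos (y + \<nu>)) | \<mu> \<nu>. True}"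

definition exceptional_points :: "(real \<times> real) set"
  where "exceptional_points =
    {(1, 0), (-1, 0), (0, 1), (0, -1),
     (1 / sqrt 2, 1 / sqrt 2), (1 / sqrt 2, - 1 / sqrt 2),
     (- 1 / sqrt 2, 1 / sqrt 2), (- 1 / sqrt 2, - 1 / sqrt 2)}"

end

theory Submission
  imports Defs
begin

text \<open>
  Enstrophy minus energy is conserved, vanishes on the first eigenspace of the Laplacian and, by the
  spectral gap, is equivalent to the squared $L^2$ norm of the remaining modes. Hence a solution
  starting within $\epsilon$ of the orbit stays within $O(\epsilon)$ of the first eigenspace, where it
  looks like $r\cos(x+\mu)+s\cos(y+\nu)$. The enstrophy then fixes $r^2+s^2$ and the Casimir
  $\int F(\omega)$ with $F(s)=s^4$ near the relevant range fixes $r^2s^2$, both up to $O(\epsilon)$, so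
  $(r^2-s^2)^2$ is known up to $O(\epsilon)$. If $\alpha^2\neq\beta^2$, continuity in time fixes the sign
  of $r^2-s^2$, and $r^2$, $s^2$ are known up to $O(\epsilon)$; if $\alpha^2=\beta^2$ only up to
  $O(\sqrt\epsilon)$. A further square root is lost in passing from $r^2$ to $r$ if $\alpha=0$, and
  similarly for $\beta=0$.
\<close>

section \<open>Integration over the torus\<close>

text \<open>The fourth power is the lowest one that helps: on the first eigenspace the first and
  third moments vanish and the second repeats the enstrophy, while the fourth contains the cross
  term r^2 s^2. Since the orbit contains all phases, the distance of an element of the eigenspace to
  it is governed by the amplitudes r and s alone, so the flow is reduced to two continuous functions
  of time.

  The obstacle is the energy. A solution comes with a stream function at each time separately, of
  class C^2 in space and with no stated regularity in time, so the energy cannot be differentiated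
  directly. It is expanded around a fixed time instead: the linear part pairs the vorticity with a
  frozen stream function, and the quadratic remainder is bounded by the enstrophy of the difference,
  which has a double zero.

  The gap lies between the eigenvalues 1 and 2: a mode k contributes to enstrophy minus energy the
  fraction 1 - 1/|k|^2 of its squared norm, which is at least 1/2 off the first eigenspace.\<close>

abbreviation fundamental_square :: "(real \<times> real) set"
  where "fundamental_square \<equiv> cbox (0, 0) (2 * pi, 2 * pi)"

lemma torus_integral_eq:
  assumes "continuous_on UNIV f"
  shows "torus_integral f = integral fundamental_square f"
proof -
  have "continuous_on fundamental_square f"
    using assms continuous_on_subset by blast
  then have "set_integrable lborel fundamental_square f"
    unfolding set_integrable_def by (intro borel_integrable_compact) auto
  then show ?thesis
    unfolding torus_integral_def cbox_Pair_eq[symmetric] cbox_interval[symmetric]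
    by (simp add: set_borel_integral_eq_integral(2))
qed

lemma continuous_integrable_square:
  fixes f :: "real \<times> real \<Rightarrow> real"
  shows "continuous_on UNIV f \<Longrightarrow> f integrable_on fundamental_square"
  using continuous_on_subset integrable_continuous by blast

lemma torus_integral_add:
  assumes "continuous_on UNIV f" "continuous_on UNIV g"
  shows "torus_integral (\<lambda>z. f z + g z) = torus_integral f + torus_integral g"
  using assms by (simp add: torus_integral_eq continuous_on_add integral_add continuous_integrable_square)

lemma torus_integral_diff:
  assumes "continuous_on UNIV f" "continuous_on UNIV g"
  shows "torus_integral (\<lambda>z. f z - g z) = torus_integral f - torus_integral g"
  using assms by (simp add: torus_integral_eq continuous_on_diff integral_diff continuous_integrable_square)

lemma torus_integral_cmult: "torus_integral (\<lambda>z. c * f z) = c * torus_integral f"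
  by (simp add: torus_integral_def)

lemma torus_integral_minus: "torus_integral (\<lambda>z. - f z) = - torus_integral f"
  using torus_integral_cmult[of "-1" f] by simp

lemma torus_integral_const: "torus_integral (\<lambda>z. c) = 4 * pi\<^sup>2 * c"
proof -
  have "torus_integral (\<lambda>z. c) = integral fundamental_square (\<lambda>z. c)"
    by (rule torus_integral_eq) (rule continuous_on_const)
  also have "\<dots> = 4 * pi\<^sup>2 * c"
    by (simp add: content_Pair power2_eq_square)
  finally show ?thesis .
qed

lemma torus_integral_sum:
  assumes "finite K" "\<And>k. k \<in> K \<Longrightarrow> continuous_on UNIV (f k)"
  shows "torus_integral (\<lambda>z. \<Sum>k\<in>K. f k z) = (\<Sum>k\<in>K. torus_integral (f k))"
  using assms
proof (induction K rule: finite_induct)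
  case empty
  then show ?case using torus_integral_const[of 0] by simp
next
  case (insert k K)
  have "continuous_on UNIV (\<lambda>z. \<Sum>k\<in>K. f k z)"
    using insert by (intro continuous_on_sum) auto
  then show ?case using insert by (simp add: torus_integral_add)
qed

lemma torus_integral_mono:
  assumes "continuous_on UNIV f" "continuous_on UNIV g" "\<And>z. z \<in> fundamental_square \<Longrightarrow> f z \<le> g z"
  shows "torus_integral f \<le> torus_integral g"
  using assms by (simp add: torus_integral_eq integral_le continuous_integrable_square)

lemma torus_integral_nonneg:
  assumes "\<And>z. 0 \<le> f z"
  shows "0 \<le> torus_integral f"
  unfolding torus_integral_def set_lebesgue_integral_def using assms
  by (intro Bochner_Integration.integral_nonneg) auto

lemma torus_integral_Fubini:
  assumes "continuous_on UNIV f"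
  shows "torus_integral f = integral {0..2 * pi} (\<lambda>x. integral {0..2 * pi} (\<lambda>y. f (x, y)))"
    and "torus_integral f = integral {0..2 * pi} (\<lambda>y. integral {0..2 * pi} (\<lambda>x. f (x, y)))"
proof -
  have c: "continuous_on fundamental_square f" using assms continuous_on_subset by blast
  show 1: "torus_integral f = integral {0..2 * pi} (\<lambda>x. integral {0..2 * pi} (\<lambda>y. f (x, y)))"
    using integral_prod_continuous[of 0 0 "2*pi" "2*pi" f] c torus_integral_eq[OF assms] by simp
  show "torus_integral f = integral {0..2 * pi} (\<lambda>y. integral {0..2 * pi} (\<lambda>x. f (x, y)))"
    unfolding 1 using integral_swap_continuous[of 0 0 "2*pi" "2*pi" "\<lambda>x y. f (x, y)"] c by simp
qed

text \<open>Applied to the Fourier coefficients of a solution, it makes the amplitudes continuous in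
  time; the choice of a branch of the square root rests on this.\<close>

lemma continuous_torus_integral_param:
  fixes G :: "real \<times> real \<times> real \<Rightarrow> real"
  assumes "continuous_on UNIV G"
  shows "continuous_on UNIV (\<lambda>t. torus_integral (\<lambda>z. G (t, z)))"
proof -
  have "continuous_on UNIV (\<lambda>z. G (t, z))" for t
    by (intro continuous_on_compose2[OF assms] continuous_intros) auto
  moreover have "continuous_on (UNIV \<times> fundamental_square) (\<lambda>(t, z). G (t, z))"
    using assms continuous_on_subset by fastforce
  ultimately show ?thesis
    using integral_continuous_on_param[of UNIV "(0,0)" "(2*pi,2*pi)" "\<lambda>t z. G (t, z)"]
    by (simp add: torus_integral_eq)
qed

lemma torus_integral_Leibniz:
  fixes G G' :: "real \<times> real \<times> real \<Rightarrow> real"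
  assumes G: "continuous_on UNIV G" and G': "continuous_on UNIV G'"
    and D: "\<And>t z. ((\<lambda>s. G (s, z)) has_real_derivative G' (t, z)) (at t)"
  shows "((\<lambda>t. torus_integral (\<lambda>z. G (t, z))) has_real_derivative
           torus_integral (\<lambda>z. G' (t, z))) (at t)"
proof -
  have c: "continuous_on UNIV (\<lambda>z. G (t, z))" "continuous_on UNIV (\<lambda>z. G' (t, z))" for t
    by (intro continuous_on_compose2[OF G] continuous_on_compose2[OF G'] continuous_intros; auto)+
  have "((\<lambda>t. integral fundamental_square (\<lambda>z. G (t, z))) has_real_derivative
           integral fundamental_square (\<lambda>z. G' (t, z))) (at t within UNIV)"
  proof (rule leibniz_rule_field_derivative)
    show "(\<lambda>z. G (s, z)) integrable_on fundamental_square" for s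
      using c(1) by (rule continuous_integrable_square)
    show "continuous_on (UNIV \<times> fundamental_square) (\<lambda>(t, z). G' (t, z))"
      using G' continuous_on_subset by fastforce
  qed (auto intro: D)
  then show ?thesis using c by (simp add: torus_integral_eq)
qed

text \<open>The quadratic polynomial in s given by the integral of (f + s g)^2 is nonnegative, and
  its value at the minimum gives the claim.\<close>

lemma torus_integral_Cauchy_Schwarz:
  assumes f: "continuous_on UNIV f" and g: "continuous_on UNIV g"
  shows "(torus_integral (\<lambda>z. f z * g z))\<^sup>2
           \<le> torus_integral (\<lambda>z. (f z)\<^sup>2) * torus_integral (\<lambda>z. (g z)\<^sup>2)"
proof -
  let ?A = "torus_integral (\<lambda>z. (f z)\<^sup>2)" and ?B = "torus_integral (\<lambda>z. f z * g z)"
    and ?C = "torus_integral (\<lambda>z. (g z)\<^sup>2)"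
  have q: "0 \<le> ?A + (2 * s) * ?B + s\<^sup>2 * ?C" for s
  proof -
    have "0 \<le> torus_integral (\<lambda>z. (f z + s * g z)\<^sup>2)"
      by (rule torus_integral_nonneg) simp
    also have "(\<lambda>z. (f z + s * g z)\<^sup>2) = (\<lambda>z. ((f z)\<^sup>2 + (2 * s) * (f z * g z)) + s\<^sup>2 * (g z)\<^sup>2)"
      by (auto simp: power2_eq_square algebra_simps)
    also have "torus_integral \<dots> = ?A + (2 * s) * ?B + s\<^sup>2 * ?C"
      using f g by (simp add: torus_integral_add torus_integral_cmult continuous_intros)
    finally show ?thesis .
  qed
  have C: "0 \<le> ?C" by (rule torus_integral_nonneg) simp
  show ?thesis
  proof (cases "?C = 0")
    case True
    have "?B = 0"
    proof (rule ccontr)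
      assume "?B \<noteq> 0"
      \<comment> \<open>With \<open>?C\<close> zero the polynomial is affine in s; this s gives it
        the value -1.\<close>
      then show False using q[of "- (?A + 1) / (2 * ?B)"] True by (simp add: field_simps)
    qed
    then show ?thesis using True by simp
  next
    case False
    then have "0 \<le> (?A + (2 * (- ?B / ?C)) * ?B + (- ?B / ?C)\<^sup>2 * ?C) * ?C"
      using q[of "- ?B / ?C"] C by (intro mult_nonneg_nonneg) auto
    also have "\<dots> = ?A * ?C - ?B\<^sup>2"
      using False by (simp add: field_simps power2_eq_square)
    finally show ?thesis by simp
  qed
qed

section \<open>Periodic C^1 functions and integration by parts\<close>

definition C1_torus :: "(real \<times> real \<Rightarrow> real) \<Rightarrow> (real \<times> real \<Rightarrow> real) \<Rightarrow> (real \<times> real \<Rightarrow> real) \<Rightarrow> bool"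
  where "C1_torus f fx fy \<longleftrightarrow>
    continuous_on UNIV f \<and> continuous_on UNIV fx \<and> continuous_on UNIV fy \<and> torus_periodic f \<and>
    (\<forall>x y. ((\<lambda>s. f (s, y)) has_real_derivative fx (x, y)) (at x)) \<and>
    (\<forall>x y. ((\<lambda>s. f (x, s)) has_real_derivative fy (x, y)) (at y))"

lemma C1_torus_cont:
  assumes "C1_torus f fx fy"
  shows "continuous_on UNIV f" "continuous_on UNIV fx" "continuous_on UNIV fy"
  using assms by (auto simp: C1_torus_def)

lemma C1_torus_mult:
  assumes "C1_torus f fx fy" "C1_torus g gx gy"
  shows "C1_torus (\<lambda>z. f z * g z) (\<lambda>z. fx z * g z + f z * gx z) (\<lambda>z. fy z * g z + f z * gy z)"
  using assms unfolding C1_torus_def torus_periodic_def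
  by (auto intro!: continuous_intros derivative_eq_intros)

lemma C1_torus_add:
  assumes "C1_torus f fx fy" "C1_torus g gx gy"
  shows "C1_torus (\<lambda>z. f z + g z) (\<lambda>z. fx z + gx z) (\<lambda>z. fy z + gy z)"
  using assms unfolding C1_torus_def torus_periodic_def
  by (auto intro!: continuous_intros derivative_eq_intros)

lemma C1_torus_cmult:
  assumes "C1_torus f fx fy"
  shows "C1_torus (\<lambda>z. c * f z) (\<lambda>z. c * fx z) (\<lambda>z. c * fy z)"
  using assms unfolding C1_torus_def torus_periodic_def
  by (auto intro!: continuous_intros derivative_eq_intros)

lemma C1_torus_compose:
  assumes f: "C1_torus f fx fy"
    and F: "\<And>s. (F has_real_derivative F' s) (at s)" and F': "continuous_on UNIV F'"
  shows "C1_torus (\<lambda>z. F (f z)) (\<lambda>z. F' (f z) * fx z) (\<lambda>z. F' (f z) * fy z)"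
proof -
  have "continuous_on UNIV F"
    using F by (meson DERIV_isCont continuous_at_imp_continuous_on)
  then have "continuous_on UNIV (\<lambda>z. F (f z))" "continuous_on UNIV (\<lambda>z. F' (f z))"
    using f F' by (auto simp: C1_torus_def intro: continuous_on_compose2)
  then show ?thesis
    using f unfolding C1_torus_def torus_periodic_def
    by (auto intro!: continuous_intros DERIV_chain2[OF F])
qed

text \<open>\<open>C1_torus\<close> asks for periodicity of f alone; translating f and uniqueness of
  derivatives pass it on to the partials in both variables. Hence the first partials of a C^2
  function qualify for \<open>C1_torus\<close> themselves.\<close>

lemma C1_torus_partial_periodic:
  assumes "C1_torus f fx fy"
  shows "torus_periodic fx" "torus_periodic fy"
proof -
  have dx: "((\<lambda>s. f (s, y)) has_real_derivative fx (x, y)) (at x)"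
    and dy: "((\<lambda>s. f (x, s)) has_real_derivative fy (x, y)) (at y)"
    and p: "f (x + 2 * pi, y) = f (x, y)" "f (x, y + 2 * pi) = f (x, y)" for x y
    using assms by (auto simp: C1_torus_def torus_periodic_def)
  have "((\<lambda>s. f (s + 2 * pi, y)) has_real_derivative fx (x + 2 * pi, y)) (at x)"
    "((\<lambda>s. f (x, s + 2 * pi)) has_real_derivative fy (x, y + 2 * pi)) (at y)" for x y
    using dx[of y "x + 2 * pi"] dy[of x "y + 2 * pi"] by (simp_all only: DERIV_shift)
  moreover have "((\<lambda>s. f (s, y + 2 * pi)) has_real_derivative fx (x, y + 2 * pi)) (at x)"
    "((\<lambda>s. f (x + 2 * pi, s)) has_real_derivative fy (x + 2 * pi, y)) (at y)" for x y
    by (auto intro!: dx dy)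
  ultimately show "torus_periodic fx" "torus_periodic fy"
    unfolding torus_periodic_def p by (metis DERIV_unique dx dy)+
qed

text \<open>Fubini is used in the order that integrates first along the differentiated variable,
  where the fundamental theorem of calculus and periodicity give zero.\<close>

lemma torus_integral_partial:
  assumes "C1_torus f fx fy"
  shows "torus_integral fx = 0" "torus_integral fy = 0"
proof -
  have dx: "((\<lambda>s. f (s, y)) has_real_derivative fx (x, y)) (at x)"
    and dy: "((\<lambda>s. f (x, s)) has_real_derivative fy (x, y)) (at y)"
    and p: "f (x + 2 * pi, y) = f (x, y)" "f (x, y + 2 * pi) = f (x, y)" for x y
    using assms by (auto simp: C1_torus_def torus_periodic_def)
  have "((\<lambda>x. fx (x, y)) has_integral (f (2 * pi, y) - f (0, y))) {0..2 * pi}"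
    "((\<lambda>y. fy (x, y)) has_integral (f (x, 2 * pi) - f (x, 0))) {0..2 * pi}" for x y
    by (rule fundamental_theorem_of_calculus;
        use dx dy in \<open>auto simp flip: has_real_derivative_iff_has_vector_derivative
          intro: has_field_derivative_at_within\<close>)+
  then have "integral {0..2 * pi} (\<lambda>x. fx (x, y)) = 0"
    "integral {0..2 * pi} (\<lambda>y. fy (x, y)) = 0" for x y
    using p[of 0] p(2)[of x 0 for x] by (auto dest!: integral_unique)
  then show "torus_integral fx = 0" "torus_integral fy = 0"
    using C1_torus_cont[OF assms] by (simp_all add: torus_integral_Fubini(2)[of fx] torus_integral_Fubini(1)[of fy])
qed

lemma torus_integral_by_parts:
  assumes f: "C1_torus f fx fy" and g: "C1_torus g gx gy"
  shows "torus_integral (\<lambda>z. fx z * g z) = - torus_integral (\<lambda>z. f z * gx z)"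
    and "torus_integral (\<lambda>z. fy z * g z) = - torus_integral (\<lambda>z. f z * gy z)"
  using torus_integral_partial[OF C1_torus_mult[OF f g]] C1_torus_cont[OF f] C1_torus_cont[OF g]
  by (simp_all add: torus_integral_add continuous_intros)

section \<open>Real Fourier series on the torus\<close>

text \<open>
  The Hartley kernel $\cos + \sin$ yields an orthogonal system of real functions indexed by all pairs
  of integers, so neither complex exponentials nor separate sine and cosine families are needed.
\<close>

definition cas :: "int \<times> int \<Rightarrow> real \<times> real \<Rightarrow> real"
  where "cas k z = cos (of_int (fst k) * fst z + of_int (snd k) * snd z)
                 + sin (of_int (fst k) * fst z + of_int (snd k) * snd z)"

text \<open>The derivative of cos + sin is cos - sin, the same kernel at the opposite frequency. So
  differentiation reflects k to -k where the complex exponential would produce an imaginary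
  factor.\<close>

lemma C1_torus_cas:
  "C1_torus (cas k) (\<lambda>z. of_int (fst k) * cas (- k) z) (\<lambda>z. of_int (snd k) * cas (- k) z)"
proof -
  have *: "cos (- (a * x) - b * y) = cos (a * x + b * y)"
       "sin (- (a * x) - b * y) = - sin (a * x + b * y)" for a b x y :: real
    using cos_minus[of "a * x + b * y"] sin_minus[of "a * x + b * y"] by simp_all
  have "torus_periodic (cas k)"
    unfolding torus_periodic_def
  proof (intro allI)
    fix x y
    have *: "of_int (fst k) * (x + 2 * pi) + of_int (snd k) * y
            = (of_int (fst k) * x + of_int (snd k) * y) + 2 * pi * of_int (fst k)"
         "of_int (fst k) * x + of_int (snd k) * (y + 2 * pi)
            = (of_int (fst k) * x + of_int (snd k) * y) + 2 * pi * of_int (snd k)"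
      by (simp_all add: algebra_simps)
    show "cas k (x + 2 * pi, y) = cas k (x, y) \<and> cas k (x, y + 2 * pi) = cas k (x, y)"
      unfolding cas_def fst_conv snd_conv *
      unfolding cos_add[of _ "2 * pi * _"] sin_add[of _ "2 * pi * _"] by simp
  qed
  then show ?thesis
    unfolding C1_torus_def cas_def
    by (auto simp: * algebra_simps intro!: continuous_intros derivative_eq_intros)
qed

lemma continuous_cas [continuous_intros]: "continuous_on S (cas k)"
  using C1_torus_cont(1)[OF C1_torus_cas] continuous_on_subset by blast

lemma cas_0 [simp]: "cas 0 z = 1"
  by (simp add: cas_def)

text \<open>Each component of k times \<open>cas k\<close> is, up to sign, a partial derivative of
  the periodic function \<open>cas (- k)\<close>, so it integrates to zero; a nonzero k has a
  nonzero component.\<close>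

lemma torus_integral_cas: "torus_integral (cas k) = (if k = 0 then 4 * pi\<^sup>2 else 0)"
proof -
  have "of_int (fst k) * torus_integral (cas k) = 0" "of_int (snd k) * torus_integral (cas k) = 0"
    using torus_integral_partial[OF C1_torus_cas[of "- k"]] by (simp_all add: torus_integral_cmult torus_integral_minus)
  moreover have "torus_integral (cas 0) = 4 * pi\<^sup>2"
    using torus_integral_const[of 1] unfolding cas_0[abs_def] by simp
  moreover have "k = 0" if "fst k = 0" "snd k = 0"
    using that by (simp add: prod_eq_iff)
  ultimately show ?thesis by auto
qed

text \<open>(cos a + sin a)(cos b + sin b) = cos (a - b) + sin (a + b), and the even and odd parts
  of the kernel give back the cosine and the sine.\<close>

lemma cas_mult:
  "cas k z * cas l z = (cas (k - l) z + cas (l - k) z) / 2 + (cas (k + l) z - cas (- (k + l)) z) / 2"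
proof -
  define a where "a = of_int (fst k) * fst z + of_int (snd k) * snd z"
  define b where "b = of_int (fst l) * fst z + of_int (snd l) * snd z"
  have c: "cas k z = cos a + sin a" "cas l z = cos b + sin b"
    "cas (k - l) z = cos (a - b) + sin (a - b)" "cas (l - k) z = cos (a - b) - sin (a - b)"
    "cas (k + l) z = cos (a + b) + sin (a + b)" "cas (- (k + l)) z = cos (a + b) - sin (a + b)"
    using cos_minus[of "a - b"] sin_minus[of "a - b"] cos_minus[of "a + b"] sin_minus[of "a + b"]
    by (simp_all add: cas_def a_def b_def algebra_simps)
  show ?thesis unfolding c by (simp add: cos_add sin_add cos_diff field_simps)
qed

lemma torus_integral_cas_mult:
  "torus_integral (\<lambda>z. cas k z * cas l z) = (if k = l then 4 * pi\<^sup>2 else 0)"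
proof -
  have "torus_integral (\<lambda>z. cas k z * cas l z)
      = (1 / 2) * torus_integral (\<lambda>z. (cas (k - l) z + cas (l - k) z) + (cas (k + l) z - cas (- (k + l)) z))"
    unfolding cas_mult torus_integral_cmult[symmetric]
    by (simp add: add_divide_distrib diff_divide_distrib)
  also have "\<dots> = (1 / 2) * ((torus_integral (cas (k - l)) + torus_integral (cas (l - k)))
                   + (torus_integral (cas (k + l)) - torus_integral (cas (- (k + l)))))"
    by (simp add: torus_integral_add torus_integral_diff continuous_intros)
  \<comment> \<open>The integrals at k + l and -(k + l) are equal in every case, even for l = -k, so
    they cancel; only the difference frequencies decide.\<close>
  finally show ?thesis 
    unfolding torus_integral_cas neg_equal_0_iff_equal by auto
qed

definition fourier_coef :: "(real \<times> real \<Rightarrow> real) \<Rightarrow> int \<times> int \<Rightarrow> real"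
  where "fourier_coef f k = torus_integral (\<lambda>z. f z * cas k z) / (4 * pi\<^sup>2)"

lemma fourier_coef_partial:
  assumes "C1_torus f fx fy"
  shows "fourier_coef fx k = - of_int (fst k) * fourier_coef f (- k)"
    and "fourier_coef fy k = - of_int (snd k) * fourier_coef f (- k)"
proof -
  have "torus_integral (\<lambda>z. fx z * cas k z) = - of_int (fst k) * torus_integral (\<lambda>z. f z * cas (- k) z)"
    "torus_integral (\<lambda>z. fy z * cas k z) = - of_int (snd k) * torus_integral (\<lambda>z. f z * cas (- k) z)"
    unfolding torus_integral_by_parts[OF assms C1_torus_cas] torus_integral_cmult[symmetric] torus_integral_minus[symmetric]
    by (simp_all add: mult.left_commute)
  then show "fourier_coef fx k = - of_int (fst k) * fourier_coef f (- k)"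
    "fourier_coef fy k = - of_int (snd k) * fourier_coef f (- k)"
    by (simp_all add: fourier_coef_def)
qed

text \<open>Orthogonality completes the square. The identity serves three times: with the Fourier
  coefficients as \<open>a\<close> it yields Bessel's inequality, with the coefficients of an
  approximating sum it yields Parseval, and on the unit modes it splits the distance to an
  eigenfunction.\<close>

lemma torus_integral_trig_sum_distance:
  assumes f: "continuous_on UNIV f" and K: "finite K"
  shows "torus_integral (\<lambda>z. (f z - (\<Sum>k\<in>K. a k * cas k z))\<^sup>2)
       = torus_integral (\<lambda>z. (f z)\<^sup>2) - 4 * pi\<^sup>2 * (\<Sum>k\<in>K. (fourier_coef f k)\<^sup>2)
         + 4 * pi\<^sup>2 * (\<Sum>k\<in>K. (a k - fourier_coef f k)\<^sup>2)"
proof -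
  define P where "P = (\<lambda>z. \<Sum>k\<in>K. a k * cas k z)"
  have P: "continuous_on UNIV P" unfolding P_def by (intro continuous_intros)
  have c: "torus_integral (\<lambda>z. f z * cas k z) = 4 * pi\<^sup>2 * fourier_coef f k" for k
    by (simp add: fourier_coef_def)
  have "torus_integral (\<lambda>z. f z * P z) = torus_integral (\<lambda>z. \<Sum>k\<in>K. a k * (f z * cas k z))"
    by (simp add: P_def sum_distrib_left algebra_simps)
  also have "\<dots> = (\<Sum>k\<in>K. a k * (4 * pi\<^sup>2 * fourier_coef f k))"
    using f K by (simp add: torus_integral_sum torus_integral_cmult c continuous_intros)
  finally have fP: "torus_integral (\<lambda>z. f z * P z) = (\<Sum>k\<in>K. a k * (4 * pi\<^sup>2 * fourier_coef f k))" .
  have "torus_integral (\<lambda>z. (P z)\<^sup>2) = torus_integral (\<lambda>z. \<Sum>k\<in>K. \<Sum>l\<in>K. (a k * a l) * (cas k z * cas l z))"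
    by (simp add: P_def power2_eq_square sum_product algebra_simps)
  also have "\<dots> = (\<Sum>k\<in>K. torus_integral (\<lambda>z. \<Sum>l\<in>K. (a k * a l) * (cas k z * cas l z)))"
    using K by (intro torus_integral_sum) (auto intro!: continuous_intros)
  also have "\<dots> = (\<Sum>k\<in>K. \<Sum>l\<in>K. torus_integral (\<lambda>z. (a k * a l) * (cas k z * cas l z)))"
    using K by (intro sum.cong refl torus_integral_sum) (auto intro!: continuous_intros)
  also have "\<dots> = (\<Sum>k\<in>K. 4 * pi\<^sup>2 * (a k)\<^sup>2)"
    using K by (simp add: torus_integral_cmult torus_integral_cas_mult if_distrib[of "\<lambda>x. _ * x"] sum.delta
        power2_eq_square mult_ac cong: if_cong)
  finally have PP: "torus_integral (\<lambda>z. (P z)\<^sup>2) = (\<Sum>k\<in>K. 4 * pi\<^sup>2 * (a k)\<^sup>2)" .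
  have "torus_integral (\<lambda>z. (f z - P z)\<^sup>2) = torus_integral (\<lambda>z. ((f z)\<^sup>2 - 2 * (f z * P z)) + (P z)\<^sup>2)"
    by (simp add: power2_diff algebra_simps)
  also have "\<dots> = torus_integral (\<lambda>z. (f z)\<^sup>2) - 2 * (\<Sum>k\<in>K. a k * (4 * pi\<^sup>2 * fourier_coef f k))
       + (\<Sum>k\<in>K. 4 * pi\<^sup>2 * (a k)\<^sup>2)"
    using f P by (simp add: torus_integral_add torus_integral_diff torus_integral_cmult fP PP continuous_intros)
  also have "\<dots> = torus_integral (\<lambda>z. (f z)\<^sup>2) - 4 * pi\<^sup>2 * (\<Sum>k\<in>K. (fourier_coef f k)\<^sup>2)
         + 4 * pi\<^sup>2 * (\<Sum>k\<in>K. (a k - fourier_coef f k)\<^sup>2)"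
    by (simp add: power2_diff sum_distrib_left sum.distrib sum_subtractf algebra_simps)
  finally show ?thesis unfolding P_def .
qed

lemma Bessel_inequality:
  assumes "continuous_on UNIV f" "finite K"
  shows "4 * pi\<^sup>2 * (\<Sum>k\<in>K. (fourier_coef f k)\<^sup>2) \<le> torus_integral (\<lambda>z. (f z)\<^sup>2)"
  using torus_integral_trig_sum_distance[OF assms, of "fourier_coef f"]
    torus_integral_nonneg[of "\<lambda>z. (f z - (\<Sum>k\<in>K. fourier_coef f k * cas k z))\<^sup>2"] by simp

section \<open>Density of trigonometric polynomials\<close>

definition trig_poly :: "(real \<times> real \<Rightarrow> real) \<Rightarrow> bool"
  where "trig_poly P \<longleftrightarrow> (\<exists>K a. finite K \<and> P = (\<lambda>z. \<Sum>k\<in>K. a k * cas k z))"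

lemma trig_poly_cmult_cas: "trig_poly (\<lambda>z. c * cas k z)"
  unfolding trig_poly_def by (rule exI[of _ "{k}"], rule exI[of _ "\<lambda>_. c"]) simp

lemma trig_poly_const: "trig_poly (\<lambda>z. c)"
  using trig_poly_cmult_cas[of c 0] by simp

lemma trig_poly_add:
  assumes "trig_poly P" "trig_poly Q"
  shows "trig_poly (\<lambda>z. P z + Q z)"
proof -
  obtain K a L b where K: "finite K" "P = (\<lambda>z. \<Sum>k\<in>K. a k * cas k z)"
    and L: "finite L" "Q = (\<lambda>z. \<Sum>k\<in>L. b k * cas k z)"
    using assms unfolding trig_poly_def by auto
  define c where "c k = (if k \<in> K then a k else 0) + (if k \<in> L then b k else 0)" for k
  have "P z + Q z = (\<Sum>k\<in>K \<union> L. c k * cas k z)" for z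
  proof -
    have "(\<Sum>k\<in>K. a k * cas k z) = (\<Sum>k\<in>K \<union> L. (if k \<in> K then a k else 0) * cas k z)"
      "(\<Sum>k\<in>L. b k * cas k z) = (\<Sum>k\<in>K \<union> L. (if k \<in> L then b k else 0) * cas k z)"
      using K(1) L(1) by (intro sum.mono_neutral_cong_left; auto)+
    then show ?thesis by (simp add: K(2) L(2) c_def distrib_right sum.distrib)
  qed
  then show ?thesis unfolding trig_poly_def using K(1) L(1) by blast
qed

lemma trig_poly_sum: "(\<And>i. i \<in> I \<Longrightarrow> trig_poly (P i)) \<Longrightarrow> trig_poly (\<lambda>z. \<Sum>i\<in>I. P i z)"
  by (induction I rule: infinite_finite_induct) (auto intro: trig_poly_add trig_poly_const)

lemma trig_poly_mult:
  assumes "trig_poly P" "trig_poly Q"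
  shows "trig_poly (\<lambda>z. P z * Q z)"
proof -
  obtain K a L b where K: "finite K" "P = (\<lambda>z. \<Sum>k\<in>K. a k * cas k z)"
    and L: "finite L" "Q = (\<lambda>z. \<Sum>k\<in>L. b k * cas k z)"
    using assms unfolding trig_poly_def by auto
  have "trig_poly (\<lambda>z. c * (cas k z * cas l z))" for c k l
  proof -
    have "trig_poly (\<lambda>z. ((c / 2) * cas (k - l) z + (c / 2) * cas (l - k) z)
        + ((c / 2) * cas (k + l) z + (- (c / 2)) * cas (- (k + l)) z))"
      by (intro trig_poly_add trig_poly_cmult_cas)
    then show ?thesis unfolding cas_mult by (simp add: field_simps)
  qed
  then have "trig_poly (\<lambda>z. \<Sum>k\<in>K. \<Sum>l\<in>L. (a k * b l) * (cas k z * cas l z))"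
    by (intro trig_poly_sum)
  then show ?thesis by (simp add: K(2) L(2) sum_product mult_ac)
qed

text \<open>Trigonometric polynomials form an algebra by \<open>cas_mult\<close>, so it is enough to
  write the four coordinates cos x, sin x, cos y, sin y through the kernels of frequencies (1, 0),
  (-1, 0), (0, 1), (0, -1).\<close>

lemma trig_poly_real_polynomial_function:
  fixes h :: "(real \<times> real) \<times> (real \<times> real) \<Rightarrow> real"
  assumes "real_polynomial_function h"
  shows "trig_poly (\<lambda>z. h ((cos (fst z), sin (fst z)), (cos (snd z), sin (snd z))))"
  using assms
proof induction
  case (linear L)
  interpret bounded_linear L by fact
  define e1 e2 e3 e4 where "e1 = L ((1, 0), (0, 0))" "e2 = L ((0, 1), (0, 0))"
     "e3 = L ((0, 0), (1, 0))" "e4 = L ((0, 0), (0, 1))"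
  have L: "L ((a, b), (c, d)) = a * e1 + b * e2 + c * e3 + d * e4" for a b c d
  proof -
    have "((a, b), (c, d)) = a *\<^sub>R ((1, 0), (0, 0)) + b *\<^sub>R ((0, 1), (0, 0))
       + c *\<^sub>R ((0, 0), (1, 0)) + d *\<^sub>R ((0, 0), (0, 1 :: real))"
      by simp
    then show ?thesis by (simp only: add scaleR e1_e2_e3_e4_def real_scaleR_def)
  qed
  have c: "cas (1, 0) z = cos (fst z) + sin (fst z)" "cas (- 1, 0) z = cos (fst z) - sin (fst z)"
    "cas (0, 1) z = cos (snd z) + sin (snd z)" "cas (0, - 1) z = cos (snd z) - sin (snd z)" for z
    by (simp_all add: cas_def)
  have "trig_poly (\<lambda>z. ((e1 + e2) / 2 * cas (1, 0) z + (e1 - e2) / 2 * cas (- 1, 0) z)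
                     + ((e3 + e4) / 2 * cas (0, 1) z + (e3 - e4) / 2 * cas (0, - 1) z))"
    by (intro trig_poly_add trig_poly_cmult_cas)
  moreover have "((e1 + e2) / 2 * cas (1, 0) z + (e1 - e2) / 2 * cas (- 1, 0) z)
      + ((e3 + e4) / 2 * cas (0, 1) z + (e3 - e4) / 2 * cas (0, - 1) z)
      = cos (fst z) * e1 + sin (fst z) * e2 + cos (snd z) * e3 + sin (snd z) * e4" for z
    unfolding c by (simp add: field_simps)
  ultimately show ?case unfolding L by simp
qed (auto intro: trig_poly_const trig_poly_add trig_poly_mult)

lemma torus_periodic_int:
  assumes "torus_periodic f"
  shows "f (x + 2 * pi * of_int m, y + 2 * pi * of_int n) = f (x, y)"
proof -
  have px: "f (x + 2 * pi, y) = f (x, y)" and py: "f (x, y + 2 * pi) = f (x, y)" for x y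
    using assms by (auto simp: torus_periodic_def)
  have nx: "f (x + 2 * pi * real j, y) = f (x, y)" for j x y
    by (induction j) (use px[of "x + 2 * pi * real j" y for j] in \<open>auto simp: algebra_simps\<close>)
  have ny: "f (x, y + 2 * pi * real j) = f (x, y)" for j x y
    by (induction j) (use py[of x "y + 2 * pi * real j" for j] in \<open>auto simp: algebra_simps\<close>)
  have "f (x + 2 * pi * of_int m, y) = f (x, y)" for x y
    using nx[of x "nat m" y] nx[of "x + 2 * pi * of_int m" "nat (- m)" y] by (cases "m \<ge> 0") auto
  moreover have "f (x, y + 2 * pi * of_int n) = f (x, y)" for x y
    using ny[of x y "nat n"] ny[of x "y + 2 * pi * of_int n" "nat (- n)"] by (cases "n \<ge> 0") auto
  ultimately show ?thesis by simp
qed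

text \<open>The map \<open>p\<close> embeds the torus into R^4 with compact image \<open>T\<close>.
  A periodic f descends to a function \<open>g\<close> on \<open>T\<close>, and Stone-Weierstrass
  approximates \<open>g\<close> by polynomials in the four coordinates.\<close>

lemma trig_poly_dense:
  assumes f: "continuous_on UNIV f" and per: "torus_periodic f" and e: "0 < e"
  obtains P where "trig_poly P" "\<And>z. z \<in> fundamental_square \<Longrightarrow> \<bar>f z - P z\<bar> < e"
proof -
  define p where "p = (\<lambda>z :: real \<times> real. ((cos (fst z), sin (fst z)), (cos (snd z), sin (snd z))))"
  define T where "T = p ` fundamental_square"
  define g where "g = (\<lambda>w. f (SOME z. p z = w))"
  have fp: "f z = f z'" if "p z = p z'" for z z'
  proof -
    have "sin (fst z) = sin (fst z') \<and> cos (fst z) = cos (fst z')"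
      "sin (snd z) = sin (snd z') \<and> cos (snd z) = cos (snd z')"
      using \<open>p z = p z'\<close> unfolding p_def by auto
    then obtain m n where "fst z = fst z' + 2 * pi * of_int m" "snd z = snd z' + 2 * pi * of_int n"
      unfolding sin_cos_eq_iff by (auto simp: mult_ac)
    then have "z = (fst z' + 2 * pi * of_int m, snd z' + 2 * pi * of_int n)"
      by (simp add: prod_eq_iff)
    then show ?thesis using torus_periodic_int[OF per, of "fst z'" m "snd z'" n] by simp
  qed
  have gp: "g (p z) = f z" for z
    unfolding g_def by (rule fp) (rule someI[of _ z], rule refl)
  have p: "continuous_on A p" for A unfolding p_def by (intro continuous_intros)
  have "compact T" unfolding T_def by (intro compact_continuous_image p compact_cbox)
  \<comment> \<open>A continuous map of a compact set onto a Hausdorff image is a quotient map, so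
    openness in \<open>T\<close> may be tested on preimages in the square, where \<open>g\<close>
    becomes f.\<close>
  moreover have "continuous_on T g"
  proof (intro continuous_on_open_gen[THEN iffD2, of _ _ UNIV] allI impI)
    show "g \<in> T \<rightarrow> UNIV" by simp
    fix U :: "real set" assume U: "openin (top_of_set UNIV) U"
    have "p z \<in> T \<inter> g -` U \<longleftrightarrow> f z \<in> U" if "z \<in> fundamental_square" for z
      using that by (simp add: T_def gp)
    then have "fundamental_square \<inter> p -` (T \<inter> g -` U) = fundamental_square \<inter> f -` U"
      by blast
    moreover have "openin (top_of_set fundamental_square) (fundamental_square \<inter> f -` U)"
      using U continuous_on_subset[OF f, of fundamental_square]
      by (intro continuous_openin_preimage_gen) auto
    ultimately show "openin (top_of_set T) (T \<inter> g -` U)"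
      using Abstract_Topology_2.continuous_imp_quotient_map[of fundamental_square p T "T \<inter> g -` U"] p T_def by auto
  qed
  ultimately obtain h where h: "real_polynomial_function h" "\<And>w. w \<in> T \<Longrightarrow> \<bar>g w - h w\<bar> < e"
    using Stone_Weierstrass_real_polynomial_function e by blast
  show ?thesis
  proof (rule that)
    show "trig_poly (\<lambda>z. h (p z))"
      unfolding p_def using h(1) by (rule trig_poly_real_polynomial_function)
    show "\<bar>f z - h (p z)\<bar> < e" if "z \<in> fundamental_square" for z
      using h(2)[of "p z"] that by (auto simp: T_def gp)
  qed
qed

section \<open>Parseval and Poincare\<close>

lemma Parseval_approx:
  assumes f: "continuous_on UNIV f" "torus_periodic f" and e: "0 < e"
  obtains K where "finite K"
    "torus_integral (\<lambda>z. (f z)\<^sup>2) \<le> 4 * pi\<^sup>2 * (\<Sum>k\<in>K. (fourier_coef f k)\<^sup>2) + e"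
proof -
  \<comment> \<open>The square has area 4 pi^2, so a uniform error d costs at most 4 pi^2 d^2 = e in
    the squared norm.\<close>
  define d where "d = sqrt e / (2 * pi)"
  have d: "0 < d" "4 * pi\<^sup>2 * d\<^sup>2 = e"
    using e by (auto simp: d_def power_divide power_mult_distrib)
  obtain P where "trig_poly P" and P: "\<And>z. z \<in> fundamental_square \<Longrightarrow> \<bar>f z - P z\<bar> < d"
    using trig_poly_dense[OF f d(1)] by blast
  then obtain K a where K: "finite K" "P = (\<lambda>z. \<Sum>k\<in>K. a k * cas k z)"
    unfolding trig_poly_def by auto
  have Pc: "continuous_on UNIV P" unfolding K by (intro continuous_intros)
  \<comment> \<open>Among all sums over the frequencies \<open>K\<close> the Fourier sum is closest
    to f, in particular no farther away than P.\<close>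
  have "torus_integral (\<lambda>z. (f z)\<^sup>2) - 4 * pi\<^sup>2 * (\<Sum>k\<in>K. (fourier_coef f k)\<^sup>2)
      \<le> torus_integral (\<lambda>z. (f z - P z)\<^sup>2)"
    unfolding K(2) torus_integral_trig_sum_distance[OF f(1) K(1)]
    by (simp add: sum_nonneg)
  also have "\<dots> \<le> torus_integral (\<lambda>z. d\<^sup>2)"
  proof (rule torus_integral_mono)
    show "(f z - P z)\<^sup>2 \<le> d\<^sup>2" if "z \<in> fundamental_square" for z
      using P[OF that] d(1) by (intro abs_le_square_iff[THEN iffD1]) auto
  qed (use f Pc in \<open>auto intro!: continuous_intros\<close>)
  finally show ?thesis
    using that[OF K(1)] d(2) by (simp add: torus_integral_const)
qed

lemma torus_integral_square_eq_0:
  assumes f: "continuous_on UNIV f" "torus_periodic f" and c: "\<And>k. fourier_coef f k = 0"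
  shows "torus_integral (\<lambda>z. (f z)\<^sup>2) = 0"
proof -
  have "torus_integral (\<lambda>z. (f z)\<^sup>2) \<le> e" if "0 < e" for e
    using Parseval_approx[OF f that] c by auto
  then show ?thesis
    using torus_integral_nonneg[of "\<lambda>z. (f z)\<^sup>2"]
    by (metis dense_ge nle_le zero_le_power2 order.antisym)
qed

text \<open>Parseval up to an error is applied to f, and Bessel's inequality to the two partials,
  whose coefficients are those of f times the components of the frequency.\<close>

lemma torus_Poincare:
  assumes f: "C1_torus f fx fy"
    and low: "\<And>k. fourier_coef f k \<noteq> 0 \<Longrightarrow> m \<le> of_int ((fst k)\<^sup>2 + (snd k)\<^sup>2)" and m: "0 < m"
  shows "m * torus_integral (\<lambda>z. (f z)\<^sup>2) \<le> torus_integral (\<lambda>z. (fx z)\<^sup>2) + torus_integral (\<lambda>z. (fy z)\<^sup>2)"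
proof (rule field_le_epsilon)
  fix e :: real assume e: "0 < e"
  have per: "torus_periodic f" using f by (simp add: C1_torus_def)
  obtain K where K: "finite K"
    "torus_integral (\<lambda>z. (f z)\<^sup>2) \<le> 4 * pi\<^sup>2 * (\<Sum>k\<in>K. (fourier_coef f k)\<^sup>2) + e / m"
    using Parseval_approx[OF C1_torus_cont(1)[OF f] per, of "e / m"] e m by auto
  have "m * torus_integral (\<lambda>z. (f z)\<^sup>2) \<le> m * (4 * pi\<^sup>2 * (\<Sum>k\<in>K. (fourier_coef f k)\<^sup>2) + e / m)"
    using K m by (intro mult_left_mono) auto
  also have "\<dots> = 4 * pi\<^sup>2 * (\<Sum>k\<in>K. m * (fourier_coef f k)\<^sup>2) + e"
    using m by (simp add: algebra_simps sum_distrib_left)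
  also have "(\<Sum>k\<in>K. m * (fourier_coef f k)\<^sup>2)
      \<le> (\<Sum>k\<in>K. of_int ((fst k)\<^sup>2 + (snd k)\<^sup>2) * (fourier_coef f k)\<^sup>2)"
  proof (rule sum_mono)
    show "m * (fourier_coef f k)\<^sup>2 \<le> of_int ((fst k)\<^sup>2 + (snd k)\<^sup>2) * (fourier_coef f k)\<^sup>2" for k
      using low[of k] by (cases "fourier_coef f k = 0") (auto intro: mult_right_mono)
  qed
  \<comment> \<open>The index set is reflected because the coefficient of a partial at -k comes from
    that of f at k.\<close>
  also have "\<dots> = (\<Sum>k\<in>uminus ` K. (fourier_coef fx k)\<^sup>2) + (\<Sum>k\<in>uminus ` K. (fourier_coef fy k)\<^sup>2)"
    by (simp add: sum.reindex fourier_coef_partial[OF f] power_mult_distrib algebra_simps sum.distrib)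
  finally have "m * torus_integral (\<lambda>z. (f z)\<^sup>2) \<le> 4 * pi\<^sup>2 * (\<Sum>k\<in>uminus ` K. (fourier_coef fx k)\<^sup>2)
       + 4 * pi\<^sup>2 * (\<Sum>k\<in>uminus ` K. (fourier_coef fy k)\<^sup>2) + e"
    by (simp add: algebra_simps)
  also have "\<dots> \<le> torus_integral (\<lambda>z. (fx z)\<^sup>2) + torus_integral (\<lambda>z. (fy z)\<^sup>2) + e"
    using Bessel_inequality[of fx "uminus ` K"] Bessel_inequality[of fy "uminus ` K"] C1_torus_cont[OF f] K(1)
    by simp
  finally show "m * torus_integral (\<lambda>z. (f z)\<^sup>2)
     \<le> torus_integral (\<lambda>z. (fx z)\<^sup>2) + torus_integral (\<lambda>z. (fy z)\<^sup>2) + e" .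
qed

section \<open>Stream functions and conservation laws\<close>

lemma Ck_imp_continuous: "Ck k f \<Longrightarrow> continuous_on UNIV f"
  by (cases k) (auto intro: differentiable_imp_continuous_on)

lemma has_real_derivative_pderiv_dir:
  fixes f :: "'a::euclidean_space \<Rightarrow> real"
  assumes f: "f differentiable_on UNIV" and g: "(g has_vector_derivative v) (at s)"
  shows "((\<lambda>s. f (g s)) has_real_derivative pderiv_dir v f (g s)) (at s)"
proof -
  have D: "(f has_derivative frechet_derivative f (at (g s))) (at (g s))"
    using f by (simp add: differentiable_on_def frechet_derivative_works)
  have "((\<lambda>s. f (g s)) has_derivative (\<lambda>h. frechet_derivative f (at (g s)) (h *\<^sub>R v))) (at s)"
    using has_derivative_compose[OF g[unfolded has_vector_derivative_def] D] .
  also have "(\<lambda>h. frechet_derivative f (at (g s)) (h *\<^sub>R v)) = (*) (pderiv_dir v f (g s))"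
    using linear_scale[OF has_derivative_linear[OF D]] by (auto simp: pderiv_dir_def mult.commute)
  finally show ?thesis unfolding has_field_derivative_def .
qed

lemma C1_torus_differentiable:
  assumes "f differentiable_on UNIV" "torus_periodic f"
    "continuous_on UNIV (dx f)" "continuous_on UNIV (dy f)"
  shows "C1_torus f (dx f) (dy f)"
proof -
  have "((\<lambda>s. (s, y)) has_vector_derivative (1, 0)) (at x)"
    "((\<lambda>s. (x, s)) has_vector_derivative (0, 1)) (at y)" for x y :: real
    by (auto intro!: derivative_eq_intros simp: has_vector_derivative_def)
  from this[THEN has_real_derivative_pderiv_dir[OF assms(1)]] show ?thesis
    using assms differentiable_imp_continuous_on[OF assms(1)]
    unfolding C1_torus_def dx_def dy_def by auto
qed

lemma C1_torus_Ck:
  assumes "Ck (Suc k) f" "torus_periodic f"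
  shows "C1_torus f (dx f) (dy f)"
proof (rule C1_torus_differentiable)
  have "Ck k (dx f)" "Ck k (dy f)"
    using assms(1) unfolding dx_def dy_def by (auto simp: Basis_prod_def)
  then show "continuous_on UNIV (dx f)" "continuous_on UNIV (dy f)"
    by (auto intro: Ck_imp_continuous)
qed (use assms in auto)

text \<open>The inverse Laplacian in a form closed under linear combinations, so that differences of
  solutions and projections onto eigenfunctions fall under the same lemmas. The two mixed second
  partials are kept as separate functions.\<close>

definition torus_potential ::
  "(real \<times> real \<Rightarrow> real) \<Rightarrow> (real \<times> real \<Rightarrow> real) \<Rightarrow> (real \<times> real \<Rightarrow> real) \<Rightarrow> (real \<times> real \<Rightarrow> real) \<Rightarrow> bool"
  where "torus_potential w p px py \<longleftrightarrow> torus_integral p = 0 \<and> C1_torus p px py \<and>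
    (\<exists>pxx pxy pyx pyy. C1_torus px pxx pxy \<and> C1_torus py pyx pyy \<and> (\<forall>z. w z = - pxx z - pyy z))"

lemma torus_potentialE:
  assumes "torus_potential w p px py"
  obtains pxx pxy pyx pyy where "torus_integral p = 0" "C1_torus p px py"
    "C1_torus px pxx pxy" "C1_torus py pyx pyy" "w = (\<lambda>z. - pxx z - pyy z)"
  using assms unfolding torus_potential_def by blast

lemma torus_potential_inv_neg_laplacian:
  assumes "inv_neg_laplacian w p"
  shows "torus_potential w p (dx p) (dy p)"
proof -
  have 2: "Ck (Suc (Suc 0)) p" and per: "torus_periodic p" and 0: "torus_integral p = 0"
    and L: "- laplacian p z = w z" for z
    using assms unfolding inv_neg_laplacian_def mean_zero_def numeral_2_eq_2 by blast+
  have w: "w z = - dx (dx p) z - dy (dy p) z" for z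
    using L[of z] by (simp add: laplacian_def)
  have p: "C1_torus p (dx p) (dy p)"
    using C1_torus_Ck[OF 2 per] .
  have "Ck (Suc 0) (dx p)" "Ck (Suc 0) (dy p)"
    using 2 unfolding dx_def dy_def by (auto simp: Basis_prod_def)
  then have "C1_torus (dx p) (dx (dx p)) (dy (dx p))" "C1_torus (dy p) (dx (dy p)) (dy (dy p))"
    by (blast intro: C1_torus_Ck C1_torus_partial_periodic[OF p])+
  then show ?thesis
    unfolding torus_potential_def using 0 p w by blast
qed

lemma torus_potential_continuous:
  assumes "torus_potential w p px py"
  shows "continuous_on UNIV w"
  using assms
proof (rule torus_potentialE)
  fix pxx pxy pyx pyy
  assume "C1_torus px pxx pxy" "C1_torus py pyx pyy" "w = (\<lambda>z. - pxx z - pyy z)"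
  then show ?thesis by (simp add: C1_torus_cont continuous_intros)
qed

lemma torus_potential_C1: "torus_potential w p px py \<Longrightarrow> C1_torus p px py"
  by (simp add: torus_potential_def)

lemma torus_potential_add:
  assumes "torus_potential w p px py" "torus_potential v q qx qy"
  shows "torus_potential (\<lambda>z. w z + v z) (\<lambda>z. p z + q z) (\<lambda>z. px z + qx z) (\<lambda>z. py z + qy z)"
proof -
  obtain pxx pxy pyx pyy where p: "torus_integral p = 0" "C1_torus p px py"
    "C1_torus px pxx pxy" "C1_torus py pyx pyy" "w = (\<lambda>z. - pxx z - pyy z)"
    using assms(1) by (rule torus_potentialE)
  obtain qxx qxy qyx qyy where q: "torus_integral q = 0" "C1_torus q qx qy"
    "C1_torus qx qxx qxy" "C1_torus qy qyx qyy" "v = (\<lambda>z. - qxx z - qyy z)"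
    using assms(2) by (rule torus_potentialE)
  have "\<forall>z. w z + v z = - (pxx z + qxx z) - (pyy z + qyy z)"
    by (simp add: p q)
  moreover have "torus_integral (\<lambda>z. p z + q z) = 0"
    using p q by (simp add: torus_integral_add C1_torus_cont)
  ultimately show ?thesis
    unfolding torus_potential_def
    using C1_torus_add[OF p(2) q(2)] C1_torus_add[OF p(3) q(3)] C1_torus_add[OF p(4) q(4)]
    by blast
qed

lemma torus_potential_cmult:
  assumes "torus_potential w p px py"
  shows "torus_potential (\<lambda>z. c * w z) (\<lambda>z. c * p z) (\<lambda>z. c * px z) (\<lambda>z. c * py z)"
  using assms
proof (rule torus_potentialE)
  fix pxx pxy pyx pyy
  assume p: "torus_integral p = 0" "C1_torus p px py"
    "C1_torus px pxx pxy" "C1_torus py pyx pyy" "w = (\<lambda>z. - pxx z - pyy z)"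
  have "\<forall>z. c * w z = - (c * pxx z) - (c * pyy z)"
    by (simp add: p algebra_simps)
  moreover have "torus_integral (\<lambda>z. c * p z) = 0"
    using p by (simp add: torus_integral_cmult)
  ultimately show ?thesis
    unfolding torus_potential_def using C1_torus_cmult p(2-4) by blast
qed

lemma torus_potential_diff:
  assumes "torus_potential w p px py" "torus_potential v q qx qy"
  shows "torus_potential (\<lambda>z. w z - v z) (\<lambda>z. p z - q z) (\<lambda>z. px z - qx z) (\<lambda>z. py z - qy z)"
  using torus_potential_add[OF assms(1) torus_potential_cmult[OF assms(2), of "-1"]] by simp

lemma torus_potential_Green:
  assumes f: "C1_torus f fx fy" and w: "torus_potential w p px py"
  shows "torus_integral (\<lambda>z. f z * w z)
       = torus_integral (\<lambda>z. fx z * px z) + torus_integral (\<lambda>z. fy z * py z)"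
  using w
proof (rule torus_potentialE)
  fix pxx pxy pyx pyy
  assume p: "C1_torus px pxx pxy" "C1_torus py pyx pyy" "w = (\<lambda>z. - pxx z - pyy z)"
  have "torus_integral (\<lambda>z. f z * w z) = torus_integral (\<lambda>z. - (f z * pxx z) - (f z * pyy z))"
    unfolding p by (simp add: algebra_simps)
  also have "\<dots> = - torus_integral (\<lambda>z. f z * pxx z) - torus_integral (\<lambda>z. f z * pyy z)"
    using C1_torus_cont[OF f] C1_torus_cont[OF p(1)] C1_torus_cont[OF p(2)]
    by (simp add: torus_integral_diff torus_integral_minus continuous_intros)
  finally show ?thesis
    using torus_integral_by_parts(1)[OF f p(1)] torus_integral_by_parts(2)[OF f p(2)] by simp
qed

text \<open>Both sides equal the integral of grad p . grad q: the inverse Laplacian is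
  self-adjoint.\<close>

lemma torus_potential_symmetric:
  assumes "torus_potential w p px py" "torus_potential v q qx qy"
  shows "torus_integral (\<lambda>z. p z * v z) = torus_integral (\<lambda>z. q z * w z)"
  using torus_potential_Green[OF torus_potential_C1[OF assms(1)] assms(2)]
    torus_potential_Green[OF torus_potential_C1[OF assms(2)] assms(1)] by (simp add: mult.commute)

lemma torus_potential_energy_nonneg:
  assumes "torus_potential w p px py"
  shows "0 \<le> torus_integral (\<lambda>z. p z * w z)"
  unfolding torus_potential_Green[OF torus_potential_C1[OF assms] assms]
  by (intro add_nonneg_nonneg torus_integral_nonneg) simp_all

text \<open>Poincare bounds m times the squared norm of p by the energy E. Expanding (m p - w)^2
  \<ge> 0 bounds 2 m E by m^2 |p|^2 + |w|^2, hence by m E + |w|^2, and m E is absorbed on the left.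
  The values used are m = 1 for mean-zero functions and m = 2 off the first eigenspace.\<close>

lemma torus_potential_energy_le:
  assumes w: "torus_potential w p px py"
    and low: "\<And>k. fourier_coef p k \<noteq> 0 \<Longrightarrow> m \<le> of_int ((fst k)\<^sup>2 + (snd k)\<^sup>2)" and m: "0 < m"
  shows "m * torus_integral (\<lambda>z. p z * w z) \<le> torus_integral (\<lambda>z. (w z)\<^sup>2)"
proof -
  let ?E = "torus_integral (\<lambda>z. p z * w z)"
  note c = C1_torus_cont[OF torus_potential_C1[OF w]] torus_potential_continuous[OF w]
  have E: "m * torus_integral (\<lambda>z. (p z)\<^sup>2) \<le> ?E"
    using torus_Poincare[OF torus_potential_C1[OF w] low m]
    unfolding torus_potential_Green[OF torus_potential_C1[OF w] w] power2_eq_square by simp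
  have "2 * m * ?E = torus_integral (\<lambda>z. (2 * m) * (p z * w z))"
    by (simp add: torus_integral_cmult)
  also have "\<dots> \<le> torus_integral (\<lambda>z. m\<^sup>2 * (p z)\<^sup>2 + (w z)\<^sup>2)"
  proof (rule torus_integral_mono)
    fix z show "2 * m * (p z * w z) \<le> m\<^sup>2 * (p z)\<^sup>2 + (w z)\<^sup>2"
      using zero_le_power2[of "m * p z - w z"] by (simp add: power2_eq_square algebra_simps)
  qed (use c in \<open>auto intro!: continuous_intros\<close>)
  also have "\<dots> = m * (m * torus_integral (\<lambda>z. (p z)\<^sup>2)) + torus_integral (\<lambda>z. (w z)\<^sup>2)"
    using c by (simp add: torus_integral_add torus_integral_cmult continuous_intros power2_eq_square)
  also have "\<dots> \<le> m * ?E + torus_integral (\<lambda>z. (w z)\<^sup>2)"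
    using E m by simp
  finally show ?thesis by simp
qed

lemma torus_potential_energy_le_enstrophy:
  assumes w: "torus_potential w p px py"
  shows "torus_integral (\<lambda>z. p z * w z) \<le> torus_integral (\<lambda>z. (w z)\<^sup>2)"
proof -
  have "1 \<le> real_of_int ((fst k)\<^sup>2 + (snd k)\<^sup>2)" if "fourier_coef p k \<noteq> 0" for k
  proof -
    have "torus_integral p = 0" using w by (simp add: torus_potential_def)
    then have "k \<noteq> 0" using that by (auto simp: fourier_coef_def)
    then have "fst k \<noteq> 0 \<or> snd k \<noteq> 0" by (auto simp: prod_eq_iff)
    then have "0 < (fst k)\<^sup>2 + (snd k)\<^sup>2" by (simp add: sum_power2_gt_zero_iff)
    then have "1 \<le> (fst k)\<^sup>2 + (snd k)\<^sup>2" by linarith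
    then show ?thesis by (simp only: of_int_1_le_iff)
  qed
  from torus_potential_energy_le[OF w this] show ?thesis by simp
qed

text \<open>
  Both mixed second derivatives have the same Fourier coefficients, so they agree in $L^2$; this is
  all that incompressibility of the velocity field needs.
\<close>

lemma torus_integral_transport:
  assumes w: "torus_potential w p px py" and f: "C1_torus f fx fy"
  shows "torus_integral (\<lambda>z. px z * fy z - py z * fx z) = 0"
  using w
proof (rule torus_potentialE)
  fix pxx pxy pyx pyy
  assume p: "C1_torus p px py" "C1_torus px pxx pxy" "C1_torus py pyx pyy"
  note c = C1_torus_cont[OF p(1)] C1_torus_cont[OF p(2)] C1_torus_cont[OF p(3)] C1_torus_cont[OF f]
  define g where "g = (\<lambda>z. pxy z - pyx z)"
  have g: "continuous_on UNIV g" unfolding g_def using c by (intro continuous_intros)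
  have "torus_periodic g"
    using C1_torus_partial_periodic[OF p(2)] C1_torus_partial_periodic[OF p(3)]
    by (simp add: torus_periodic_def g_def)
  moreover have "fourier_coef g k = 0" for k
  proof -
    have "fourier_coef g k = fourier_coef pxy k - fourier_coef pyx k"
      unfolding fourier_coef_def g_def left_diff_distrib
      using c by (simp add: torus_integral_diff diff_divide_distrib continuous_intros)
    then show ?thesis
      by (simp add: fourier_coef_partial[OF p(1)] fourier_coef_partial[OF p(2)] fourier_coef_partial[OF p(3)])
  qed
  ultimately have "torus_integral (\<lambda>z. (g z)\<^sup>2) = 0"
    by (rule torus_integral_square_eq_0[OF g])
  then have "torus_integral (\<lambda>z. g z * f z) = 0"
    using torus_integral_Cauchy_Schwarz[OF g c(10)] by simp
  then have "torus_integral (\<lambda>z. pxy z * f z) = torus_integral (\<lambda>z. pyx z * f z)"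
    using c by (simp add: g_def left_diff_distrib torus_integral_diff continuous_intros)
  then have "torus_integral (\<lambda>z. px z * fy z) = torus_integral (\<lambda>z. py z * fx z)"
    using torus_integral_by_parts(2)[OF p(2) f] torus_integral_by_parts(1)[OF p(3) f] by simp
  then show ?thesis
    using c by (simp add: torus_integral_diff continuous_intros)
qed

section \<open>Conservation laws along smooth solutions\<close>

lemma smooth_euler_solutionE:
  assumes "smooth_euler_solution \<omega>"
  obtains \<psi> wt where
    "continuous_on UNIV (\<lambda>(t, z). \<omega> t z)" "continuous_on UNIV wt"
    "\<And>t z. ((\<lambda>s. \<omega> s z) has_real_derivative wt (t, z)) (at t)"
    "\<And>t. C1_torus (\<omega> t) (dx (\<omega> t)) (dy (\<omega> t))"
    "\<And>t. torus_potential (\<omega> t) (\<psi> t) (dx (\<psi> t)) (dy (\<psi> t))"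
    "\<And>t z. wt (t, z) = dy (\<psi> t) z * dx (\<omega> t) z - dx (\<psi> t) z * dy (\<omega> t) z"
proof -
  define W where "W = (\<lambda>(t, z). \<omega> t z)"
  obtain \<psi> where \<psi>: "\<And>t. inv_neg_laplacian (\<omega> t) (\<psi> t)"
    and eq: "\<And>t z. deriv (\<lambda>s. \<omega> s z) t + perp_grad (\<psi> t) z \<bullet> grad (\<omega> t) z = 0"
    using assms unfolding smooth_euler_solution_def by blast
  have "Ck (Suc 0) W" using assms by (simp add: smooth_euler_solution_def smooth_def W_def)
  then have W: "W differentiable_on UNIV"
    and cW: "\<And>b. b \<in> Basis \<Longrightarrow> continuous_on UNIV (pderiv_dir b W)"
    by auto
  have B: "(1, 0, 0) \<in> (Basis :: (real \<times> real \<times> real) set)" "(0, 1, 0) \<in> (Basis :: (real \<times> real \<times> real) set)"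
    "(0, 0, 1) \<in> (Basis :: (real \<times> real \<times> real) set)"
    by (auto simp: Basis_prod_def zero_prod_def)
  have dt: "((\<lambda>s. \<omega> s z) has_real_derivative pderiv_dir (1, 0, 0) W (t, z)) (at t)" for t z
  proof -
    have "((\<lambda>s. (s, z)) has_vector_derivative (1, 0, 0)) (at t)"
      by (auto intro!: derivative_eq_intros simp: has_vector_derivative_def zero_prod_def)
    from has_real_derivative_pderiv_dir[OF W this] show ?thesis by (simp add: W_def)
  qed
  \<comment> \<open>The equation speaks of derivatives of the slice \<omega> t; they are those of
    the space-time function in the directions (0, h), which makes them continuous.\<close>
  have slice: "(\<omega> t has_derivative (\<lambda>h. frechet_derivative W (at (t, z)) (0, h))) (at z)" for t z
  proof -
    have "W differentiable at (t, z)" using W unfolding differentiable_on_def by blast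
    then have D: "(W has_derivative frechet_derivative W (at (t, z))) (at (t, z))"
      by (simp only: frechet_derivative_works)
    have "((\<lambda>z. (t, z)) has_derivative (\<lambda>h. (0, h))) (at z)"
      by (auto intro!: derivative_eq_intros)
    from has_derivative_compose[OF this D] show ?thesis by (simp add: W_def)
  qed
  have "dx (\<omega> t) = (\<lambda>z. pderiv_dir (0, 1, 0) W (t, z))"
    "dy (\<omega> t) = (\<lambda>z. pderiv_dir (0, 0, 1) W (t, z))" for t
    unfolding dx_def dy_def pderiv_dir_def frechet_derivative_at[OF slice, symmetric] by simp_all
  then have "continuous_on UNIV (dx (\<omega> t))" "continuous_on UNIV (dy (\<omega> t))" for t
    by (auto intro!: continuous_on_compose2[OF cW[OF B(2)]] continuous_on_compose2[OF cW[OF B(3)]]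
        continuous_intros)
  moreover have "\<omega> t differentiable_on UNIV" for t
    using slice unfolding differentiable_on_def differentiable_def by blast
  moreover have "torus_periodic (\<omega> t)" for t
    using assms by (simp add: smooth_euler_solution_def)
  ultimately have "C1_torus (\<omega> t) (dx (\<omega> t)) (dy (\<omega> t))" for t
    by (intro C1_torus_differentiable)
  moreover have "pderiv_dir (1, 0, 0) W (t, z) = dy (\<psi> t) z * dx (\<omega> t) z - dx (\<psi> t) z * dy (\<omega> t) z" for t z
    using eq[where t=t and z=z] unfolding DERIV_imp_deriv[OF dt] perp_grad_def grad_def
    by simp
  ultimately show ?thesis
    using that[of "pderiv_dir (1, 0, 0) W" \<psi>] cW[OF B(1)] dt torus_potential_inv_neg_laplacian[OF \<psi>]
      differentiable_imp_continuous_on[OF W] unfolding W_def by blast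
qed

text \<open>F(\<omega>) is transported by the same velocity as \<omega>, and this velocity is
  divergence free in the integrated sense of \<open>torus_integral_transport\<close>.\<close>

lemma casimir_conserved:
  assumes \<omega>: "smooth_euler_solution \<omega>"
    and F: "\<And>s. (F has_real_derivative F' s) (at s)" and F': "continuous_on UNIV F'"
  shows "torus_integral (\<lambda>z. F (\<omega> t z)) = torus_integral (\<lambda>z. F (\<omega> 0 z))"
  using \<omega>
proof (rule smooth_euler_solutionE)
  fix \<psi> wt
  assume c: "continuous_on UNIV (\<lambda>(t, z). \<omega> t z)" "continuous_on UNIV wt"
    and dt: "\<And>t z. ((\<lambda>s. \<omega> s z) has_real_derivative wt (t, z)) (at t)"
    and C1: "\<And>t. C1_torus (\<omega> t) (dx (\<omega> t)) (dy (\<omega> t))"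
    and \<psi>: "\<And>t. torus_potential (\<omega> t) (\<psi> t) (dx (\<psi> t)) (dy (\<psi> t))"
    and wt: "\<And>t z. wt (t, z) = dy (\<psi> t) z * dx (\<omega> t) z - dx (\<psi> t) z * dy (\<omega> t) z"
  have "continuous_on UNIV F"
    using F by (meson DERIV_isCont continuous_at_imp_continuous_on)
  then have cF: "continuous_on UNIV (\<lambda>(t, z). F (\<omega> t z))" "continuous_on UNIV (\<lambda>(t, z). F' (\<omega> t z))"
    using continuous_on_compose2[OF _ c(1), of UNIV] F' by (auto simp: case_prod_unfold)
  have "((\<lambda>t. torus_integral (\<lambda>z. F (\<omega> t z))) has_real_derivative 0) (at t)" for t
  proof -
    have "((\<lambda>t. torus_integral (\<lambda>z. (\<lambda>(t, z). F (\<omega> t z)) (t, z))) has_real_derivative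
            torus_integral (\<lambda>z. (\<lambda>(t, z). F' (\<omega> t z) * wt (t, z)) (t, z))) (at t)"
      by (rule torus_integral_Leibniz)
        (use cF c in \<open>auto intro!: continuous_intros DERIV_chain2[OF F dt] simp: case_prod_unfold\<close>)
    moreover have "torus_integral (\<lambda>z. F' (\<omega> t z) * wt (t, z))
      = - torus_integral (\<lambda>z. dx (\<psi> t) z * (F' (\<omega> t z) * dy (\<omega> t) z) - dy (\<psi> t) z * (F' (\<omega> t z) * dx (\<omega> t) z))"
      unfolding wt torus_integral_minus[symmetric] by (simp add: algebra_simps)
    moreover have "\<dots> = 0"
      using torus_integral_transport[OF \<psi> C1_torus_compose[OF C1 F F']] by simp
    ultimately show ?thesis by simp
  qed
  then show ?thesis by (metis DERIV_isconst_all)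
qed

text \<open>Differentiates a quantity at a double zero of a majorant. It is meant for the quadratic
  remainder of the energy, about which only inequalities are known.\<close>

lemma has_real_derivative_squeeze_zero:
  fixes r n :: "real \<Rightarrow> real"
  assumes n: "(n has_real_derivative 0) (at s)" and n0: "n s = 0" and r: "\<And>t. 0 \<le> r t" "\<And>t. r t \<le> n t"
  shows "(r has_real_derivative 0) (at s)"
proof -
  have r0: "r s = 0" using r[of s] n0 by simp
  have "((\<lambda>t. n t / (t - s)) \<longlongrightarrow> 0) (at s)"
    using n n0 by (simp add: has_field_derivative_iff)
  then have "((\<lambda>t. r t / (t - s)) \<longlongrightarrow> 0) (at s)"
  proof (rule Lim_null_comparison[rotated, OF tendsto_norm_zero])
    show "\<forall>\<^sub>F t in at s. norm (r t / (t - s)) \<le> norm (n t / (t - s))"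
      using r order.trans[OF r] by (intro always_eventually allI) (auto simp: abs_div intro!: divide_right_mono)
  qed
  then show ?thesis using r0 by (simp add: has_field_derivative_iff)
qed

lemma energy_conserved:
  assumes \<omega>: "smooth_euler_solution \<omega>"
  obtains \<psi> \<psi>x \<psi>y where "\<And>t. torus_potential (\<omega> t) (\<psi> t) (\<psi>x t) (\<psi>y t)"
    "\<And>t. torus_integral (\<lambda>z. \<psi> t z * \<omega> t z) = torus_integral (\<lambda>z. \<psi> 0 z * \<omega> 0 z)"
  using \<omega>
proof (rule smooth_euler_solutionE)
  fix \<psi> wt
  assume c: "continuous_on UNIV (\<lambda>(t, z). \<omega> t z)" "continuous_on UNIV wt"
    and dt: "\<And>t z. ((\<lambda>s. \<omega> s z) has_real_derivative wt (t, z)) (at t)"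
    and C1: "\<And>t. C1_torus (\<omega> t) (dx (\<omega> t)) (dy (\<omega> t))"
    and \<psi>: "\<And>t. torus_potential (\<omega> t) (\<psi> t) (dx (\<psi> t)) (dy (\<psi> t))"
    and wt: "\<And>t z. wt (t, z) = dy (\<psi> t) z * dx (\<omega> t) z - dx (\<psi> t) z * dy (\<omega> t) z"
  define E where "E t = torus_integral (\<lambda>z. \<psi> t z * \<omega> t z)" for t
  note cp = C1_torus_cont[OF torus_potential_C1[OF \<psi>]] C1_torus_cont[OF C1]
  have "(E has_real_derivative 0) (at s)" for s
  proof -
    define e where "e t = torus_integral (\<lambda>z. \<psi> s z * \<omega> t z)" for t
    define n where "n t = torus_integral (\<lambda>z. (\<omega> t z - \<omega> s z)\<^sup>2)" for t
    define r where "r t = torus_integral (\<lambda>z. (\<psi> t z - \<psi> s z) * (\<omega> t z - \<omega> s z))" for t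
    have cs: "continuous_on UNIV (\<lambda>p. f (snd p))" if "continuous_on UNIV f"
      for f :: "real \<times> real \<Rightarrow> real"
      by (intro continuous_on_compose2[OF that] continuous_intros) auto
    have c': "continuous_on UNIV (\<lambda>p. \<omega> (fst p) (snd p))" using c(1) by (simp add: case_prod_unfold)
    have "(e has_real_derivative torus_integral (\<lambda>z. \<psi> s z * wt (s, z))) (at s)"
      using torus_integral_Leibniz[of "\<lambda>p. \<psi> s (snd p) * \<omega> (fst p) (snd p)" "\<lambda>p. \<psi> s (snd p) * wt p" s]
        c' c(2) cs[OF cp(1)] DERIV_cmult[OF dt] unfolding e_def
      by (force intro!: continuous_intros)
    moreover have "torus_integral (\<lambda>z. \<psi> s z * wt (s, z)) = 0"
    proof -
      \<comment> \<open>The added products of the two partials of \<psi> cancel; they complete the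
        integrand to the transport form of the function \<psi> \<omega>.\<close>
      have "torus_integral (\<lambda>z. \<psi> s z * wt (s, z))
        = - torus_integral (\<lambda>z. dx (\<psi> s) z * (dy (\<psi> s) z * \<omega> s z + \<psi> s z * dy (\<omega> s) z)
             - dy (\<psi> s) z * (dx (\<psi> s) z * \<omega> s z + \<psi> s z * dx (\<omega> s) z))"
        unfolding wt torus_integral_minus[symmetric] by (simp add: algebra_simps)
      also have "\<dots> = 0"
        using torus_integral_transport[OF \<psi> C1_torus_mult[OF torus_potential_C1[OF \<psi>] C1]] by simp
      finally show ?thesis .
    qed
    ultimately have e: "(e has_real_derivative 0) (at s)" by simp
    have "(n has_real_derivative torus_integral (\<lambda>z. 2 * (\<omega> s z - \<omega> s z) * wt (s, z))) (at s)"
      using torus_integral_Leibniz[of "\<lambda>p. (\<omega> (fst p) (snd p) - \<omega> s (snd p))\<^sup>2"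
          "\<lambda>p. 2 * (\<omega> (fst p) (snd p) - \<omega> s (snd p)) * wt p" s]
        c' c(2) cs[OF cp(4)] dt unfolding n_def
      by (force intro!: continuous_intros derivative_eq_intros)
    then have n: "(n has_real_derivative 0) (at s)"
      using torus_integral_const[of 0] by simp
    have p: "torus_potential (\<lambda>z. \<omega> t z - \<omega> s z) (\<lambda>z. \<psi> t z - \<psi> s z)
       (\<lambda>z. dx (\<psi> t) z - dx (\<psi> s) z) (\<lambda>z. dy (\<psi> t) z - dy (\<psi> s) z)" for t
      by (rule torus_potential_diff[OF \<psi> \<psi>])
    have "(r has_real_derivative 0) (at s)"
    proof (rule has_real_derivative_squeeze_zero[OF n])
      show "n s = 0" using torus_integral_const[of 0] by (simp add: n_def)
      show "0 \<le> r t" "r t \<le> n t" for t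
        unfolding r_def n_def
        using torus_potential_energy_nonneg[OF p] torus_potential_energy_le_enstrophy[OF p] by auto
    qed
    then have "((\<lambda>t. r t + 2 * e t - E s) has_real_derivative 0) (at s)"
      using e by (auto intro!: derivative_eq_intros)
    \<comment> \<open>Expanding \<open>r\<close> produces two cross terms, which agree because the
      inverse Laplacian is self-adjoint; this accounts for the factor 2.\<close>
    moreover have "r t + 2 * e t - E s = E t" for t
    proof -
      have "r t = torus_integral (\<lambda>z. (\<psi> t z * \<omega> t z - \<psi> s z * \<omega> t z) - (\<psi> t z * \<omega> s z - \<psi> s z * \<omega> s z))"
        unfolding r_def by (simp add: algebra_simps)
      also have "\<dots> = (E t - e t) - (torus_integral (\<lambda>z. \<psi> t z * \<omega> s z) - E s)"
        unfolding E_def e_def using cp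
        by (simp add: torus_integral_diff continuous_intros)
      finally show ?thesis
        using torus_potential_symmetric[OF \<psi> \<psi>, of t s] by (simp add: e_def)
    qed
    ultimately show ?thesis by simp
  qed
  then have "E t = E 0" for t by (metis DERIV_isconst_all)
  then show ?thesis
    using that[of \<psi> "\<lambda>t. dx (\<psi> t)" "\<lambda>t. dy (\<psi> t)"] \<psi> unfolding E_def by simp
qed

section \<open>The first eigenspace\<close>

definition unit_modes :: "(int \<times> int) set"
  where "unit_modes = {(1, 0), (- 1, 0), (0, 1), (0, - 1)}"

definition eigen_sum :: "(int \<times> int \<Rightarrow> real) \<Rightarrow> real \<times> real \<Rightarrow> real"
  where "eigen_sum a z = (\<Sum>k\<in>unit_modes. a k * cas k z)"

lemma finite_unit_modes [simp]: "finite unit_modes"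
  by (simp add: unit_modes_def)

lemma sum_unit_modes:
  "(\<Sum>k\<in>unit_modes. g k) = g (1, 0) + (g (- 1, 0) + (g (0, 1) + g (0, - 1)))"
  by (simp add: unit_modes_def)

lemma unit_modesD: "k \<in> unit_modes \<Longrightarrow> (fst k)\<^sup>2 + (snd k)\<^sup>2 = 1"
  by (auto simp: unit_modes_def)

lemma not_unit_modes_norm:
  assumes "k \<notin> unit_modes" "k \<noteq> 0"
  shows "2 \<le> (fst k)\<^sup>2 + (snd k)\<^sup>2"
proof (rule ccontr)
  assume "\<not> 2 \<le> (fst k)\<^sup>2 + (snd k)\<^sup>2"
  then have le: "(fst k)\<^sup>2 + (snd k)\<^sup>2 \<le> 1" by simp
  then have "(fst k)\<^sup>2 \<le> 1" "(snd k)\<^sup>2 \<le> 1"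
    using zero_le_power2[of "fst k"] zero_le_power2[of "snd k"] by linarith+
  then have "fst k \<in> {-1, 0, 1}" "snd k \<in> {-1, 0, 1}"
    using abs_square_le_1[of "fst k"] abs_square_le_1[of "snd k"] by auto
  then show False
    using assms le by (auto simp: unit_modes_def prod_eq_iff)
qed

lemma continuous_eigen_sum [continuous_intros]: "continuous_on S (eigen_sum a)"
  unfolding eigen_sum_def by (intro continuous_intros)

text \<open>|k|^2 = 1 makes \<open>cas k\<close> an eigenfunction of eigenvalue 1, hence its own
  stream function.\<close>

lemma torus_potential_cas:
  assumes "k \<in> unit_modes"
  shows "torus_potential (cas k) (cas k) (\<lambda>z. of_int (fst k) * cas (- k) z) (\<lambda>z. of_int (snd k) * cas (- k) z)"
proof -
  have "k \<noteq> 0" using assms by (auto simp: unit_modes_def zero_prod_def)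
  then have "torus_integral (cas k) = 0" by (simp add: torus_integral_cas)
  moreover have "cas k z = - (of_int (fst k) * (of_int (fst (- k)) * cas (- (- k)) z))
      - of_int (snd k) * (of_int (snd (- k)) * cas (- (- k)) z)" for z
  proof -
    have "real_of_int ((fst k)\<^sup>2 + (snd k)\<^sup>2) * cas k z = cas k z"
      using unit_modesD[OF assms] by simp
    then show ?thesis by (simp add: power2_eq_square algebra_simps)
  qed
  ultimately show ?thesis
    unfolding torus_potential_def
    using C1_torus_cas[of k] C1_torus_cmult[OF C1_torus_cas[of "- k"]] by blast
qed

lemma torus_potential_eigen_sum:
  obtains px py where "torus_potential (eigen_sum a) (eigen_sum a) px py"
proof -
  have *: "eigen_sum a = (\<lambda>z. a (1, 0) * cas (1, 0) z + (a (- 1, 0) * cas (- 1, 0) z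
     + (a (0, 1) * cas (0, 1) z + a (0, - 1) * cas (0, - 1) z)))"
    unfolding eigen_sum_def sum_unit_modes ..
  have m: "(1, 0) \<in> unit_modes" "(- 1, 0) \<in> unit_modes" "(0, 1) \<in> unit_modes" "(0, - 1) \<in> unit_modes"
    by (simp_all add: unit_modes_def)
  note c = m[THEN torus_potential_cas, THEN torus_potential_cmult]
  note P = torus_potential_add[OF c(1)[of "a (1, 0)"] torus_potential_add[OF c(2)[of "a (- 1, 0)"]
        torus_potential_add[OF c(3)[of "a (0, 1)"] c(4)[of "a (0, - 1)"]]]]
  show ?thesis by (rule that, unfold *, rule P)
qed

lemma fourier_coef_eigen_sum:
  assumes "k \<in> unit_modes"
  shows "fourier_coef (eigen_sum a) k = a k"
proof -
  have "torus_integral (\<lambda>z. eigen_sum a z * cas k z)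
      = torus_integral (\<lambda>z. \<Sum>l\<in>unit_modes. a l * (cas l z * cas k z))"
    by (simp add: eigen_sum_def sum_distrib_right mult.assoc)
  also have "\<dots> = (\<Sum>l\<in>unit_modes. torus_integral (\<lambda>z. a l * (cas l z * cas k z)))"
    by (intro torus_integral_sum) (auto intro!: continuous_intros)
  also have "\<dots> = (\<Sum>l\<in>unit_modes. if l = k then 4 * pi\<^sup>2 * a k else 0)"
    by (intro sum.cong refl) (simp add: torus_integral_cmult torus_integral_cas_mult)
  also have "\<dots> = 4 * pi\<^sup>2 * a k"
    using assms by (simp add: sum.delta)
  finally show ?thesis by (simp add: fourier_coef_def)
qed

section \<open>The spectral gap above the first eigenspace\<close>

definition high_part :: "(real \<times> real \<Rightarrow> real) \<Rightarrow> real \<times> real \<Rightarrow> real"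
  where "high_part w z = w z - eigen_sum (fourier_coef w) z"

lemma torus_integral_eigen_distance:
  assumes "continuous_on UNIV w"
  shows "torus_integral (\<lambda>z. (w z - eigen_sum a z)\<^sup>2) = torus_integral (\<lambda>z. (high_part w z)\<^sup>2)
     + 4 * pi\<^sup>2 * (\<Sum>k\<in>unit_modes. (a k - fourier_coef w k)\<^sup>2)"
  unfolding high_part_def eigen_sum_def
  by (simp add: torus_integral_trig_sum_distance[OF assms])

lemma torus_integral_high_part:
  assumes "continuous_on UNIV w"
  shows "torus_integral (\<lambda>z. (high_part w z)\<^sup>2)
     = torus_integral (\<lambda>z. (w z)\<^sup>2) - 4 * pi\<^sup>2 * (\<Sum>k\<in>unit_modes. (fourier_coef w k)\<^sup>2)"
  unfolding high_part_def eigen_sum_def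
  by (simp add: torus_integral_trig_sum_distance[OF assms])

text \<open>Let N and R be the enstrophy and the energy of the high part. The projection
  \<open>e\<close> is its own stream function, so the terms containing \<open>e\<close> are the same
  in N and in R, and Q = N - R. The gap gives 0 \<le> 2 R \<le> N.\<close>

lemma enstrophy_minus_energy_bounds:
  assumes w: "torus_potential w p px py"
  defines "Q \<equiv> torus_integral (\<lambda>z. (w z)\<^sup>2) - torus_integral (\<lambda>z. p z * w z)"
  shows "torus_integral (\<lambda>z. (high_part w z)\<^sup>2) \<le> 2 * Q"
    and "Q \<le> torus_integral (\<lambda>z. (high_part w z)\<^sup>2)"
proof -
  define e where "e = eigen_sum (fourier_coef w)"
  obtain ex ey where e: "torus_potential e e ex ey"
    using torus_potential_eigen_sum e_def by metis
  note d = torus_potential_diff[OF w e]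
  have c: "continuous_on UNIV w" "continuous_on UNIV p" "continuous_on UNIV e"
    using torus_potential_continuous[OF w] C1_torus_cont[OF torus_potential_C1[OF w]]
      torus_potential_continuous[OF e] by auto
  define N where "N = torus_integral (\<lambda>z. (w z - e z)\<^sup>2)"
  define R where "R = torus_integral (\<lambda>z. (p z - e z) * (w z - e z))"
  have high: "torus_integral (\<lambda>z. (high_part w z)\<^sup>2) = N"
    by (simp add: N_def high_part_def e_def)
  \<comment> \<open>On the unit modes the inverse Laplacian is the identity, so p and w have equal
    coefficients there and subtracting \<open>e\<close> removes them; frequency 0 is absent since
    potentials have mean zero.\<close>
  have coef: "fourier_coef (\<lambda>z. p z - e z) k = 0" if "k \<in> unit_modes \<or> k = 0" for k
  proof (cases "k = 0")
    case True
    then show ?thesis using d by (simp add: fourier_coef_def torus_potential_def)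
  next
    case False
    then have k: "k \<in> unit_modes" using that by simp
    have "torus_integral (\<lambda>z. p z * cas k z) = torus_integral (\<lambda>z. w z * cas k z)"
      using torus_potential_symmetric[OF w torus_potential_cas[OF k]] by (simp add: mult.commute)
    then have "fourier_coef p k = fourier_coef e k"
      unfolding e_def fourier_coef_eigen_sum[OF k] by (simp add: fourier_coef_def)
    moreover have "fourier_coef (\<lambda>z. p z - e z) k = fourier_coef p k - fourier_coef e k"
      using c unfolding fourier_coef_def
      by (simp add: left_diff_distrib torus_integral_diff diff_divide_distrib continuous_intros)
    ultimately show ?thesis by simp
  qed
  have "2 \<le> real_of_int ((fst k)\<^sup>2 + (snd k)\<^sup>2)" if "fourier_coef (\<lambda>z. p z - e z) k \<noteq> 0" for k
  proof -
    have "2 \<le> (fst k)\<^sup>2 + (snd k)\<^sup>2"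
      using not_unit_modes_norm[of k] coef[of k] that by blast
    then show ?thesis by linarith
  qed
  from torus_potential_energy_le[OF d this] have R1: "2 * R \<le> N"
    by (simp add: R_def N_def)
  have R0: "0 \<le> R"
    using torus_potential_energy_nonneg[OF d] by (simp add: R_def)
  have "R = torus_integral (\<lambda>z. (p z * w z - p z * e z) - (e z * w z - (e z)\<^sup>2))"
    unfolding R_def by (simp add: algebra_simps power2_eq_square)
  also have "\<dots> = (torus_integral (\<lambda>z. p z * w z) - torus_integral (\<lambda>z. p z * e z))
     - (torus_integral (\<lambda>z. e z * w z) - torus_integral (\<lambda>z. (e z)\<^sup>2))"
    using c by (simp add: torus_integral_diff continuous_intros)
  finally have R: "R = torus_integral (\<lambda>z. p z * w z) - 2 * torus_integral (\<lambda>z. e z * w z)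
      + torus_integral (\<lambda>z. (e z)\<^sup>2)"
    using torus_potential_symmetric[OF w e] by simp
  have "N = torus_integral (\<lambda>z. ((w z)\<^sup>2 - 2 * (e z * w z)) + (e z)\<^sup>2)"
    unfolding N_def by (simp add: algebra_simps power2_eq_square)
  also have "\<dots> = (torus_integral (\<lambda>z. (w z)\<^sup>2) - 2 * torus_integral (\<lambda>z. e z * w z))
      + torus_integral (\<lambda>z. (e z)\<^sup>2)"
    using c by (simp add: torus_integral_diff torus_integral_add torus_integral_cmult continuous_intros)
  finally have "Q = N - R" using R by (simp add: Q_def)
  then show "torus_integral (\<lambda>z. (high_part w z)\<^sup>2) \<le> 2 * Q" "Q \<le> torus_integral (\<lambda>z. (high_part w z)\<^sup>2)"
    using R0 R1 high by auto
qed

text \<open>The squared amplitude of the wave in x: with a and b the coefficients of (1, 0) and (-1,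
  0), the wave is (a + b) cos x + (a - b) sin x, and (a + b)^2 + (a - b)^2 = 2 (a^2 + b^2).\<close>

definition x_energy :: "(int \<times> int \<Rightarrow> real) \<Rightarrow> real"
  where "x_energy a = 2 * ((a (1, 0))\<^sup>2 + (a (- 1, 0))\<^sup>2)"

definition y_energy :: "(int \<times> int \<Rightarrow> real) \<Rightarrow> real"
  where "y_energy a = 2 * ((a (0, 1))\<^sup>2 + (a (0, - 1))\<^sup>2)"

lemma sum_unit_modes_squares: "2 * (\<Sum>k\<in>unit_modes. (a k)\<^sup>2) = x_energy a + y_energy a"
  by (simp add: sum_unit_modes x_energy_def y_energy_def)

lemma polar_nonneg:
  fixes p q :: real
  obtains r \<mu> where "0 \<le> r" "r\<^sup>2 = p\<^sup>2 + q\<^sup>2" "\<And>x. p * cos x + q * sin x = r * cos (x + \<mu>)"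
proof -
  obtain r \<theta> where r: "p = r * cos \<theta>" "q = r * sin \<theta>" using polar_Ex by blast
  have r2: "r\<^sup>2 = p\<^sup>2 + q\<^sup>2"
    unfolding r power_mult_distrib by (metis distrib_left mult.right_neutral sin_cos_squared_add2)
  have e: "p * cos x + q * sin x = r * cos (x - \<theta>)" for x
    by (simp add: r cos_diff algebra_simps)
  show ?thesis
  proof (cases "0 \<le> r")
    case True
    then show ?thesis using that[of r "- \<theta>"] r2 e by simp
  next
    case False
    \<comment> \<open>The polar form leaves the sign of r open; a negative r is turned positive by a
      phase shift of pi.\<close>
    have "r * cos (x - \<theta>) = - r * cos (x + (pi - \<theta>))" for x
      using cos_periodic_pi[of "x - \<theta>"] by (simp add: algebra_simps)
    then show ?thesis using that[of "- r" "pi - \<theta>"] r2 e False by simp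
  qed
qed

lemma cas_unit_modes:
  "cas (1, 0) z = cos (fst z) + sin (fst z)" "cas (- 1, 0) z = cos (fst z) - sin (fst z)"
  "cas (0, 1) z = cos (snd z) + sin (snd z)" "cas (0, - 1) z = cos (snd z) - sin (snd z)"
  by (simp_all add: cas_def)

lemma eigen_sum_polar:
  obtains r s \<mu> \<nu> where "0 \<le> r" "0 \<le> s" "r\<^sup>2 = x_energy a" "s\<^sup>2 = y_energy a"
    "\<And>z. eigen_sum a z = r * cos (fst z + \<mu>) + s * cos (snd z + \<nu>)"
proof -
  obtain r \<mu> where r: "0 \<le> r" "r\<^sup>2 = (a (1, 0) + a (- 1, 0))\<^sup>2 + (a (1, 0) - a (- 1, 0))\<^sup>2"
    "\<And>x. (a (1, 0) + a (- 1, 0)) * cos x + (a (1, 0) - a (- 1, 0)) * sin x = r * cos (x + \<mu>)"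
    using polar_nonneg by blast
  obtain s \<nu> where s: "0 \<le> s" "s\<^sup>2 = (a (0, 1) + a (0, - 1))\<^sup>2 + (a (0, 1) - a (0, - 1))\<^sup>2"
    "\<And>x. (a (0, 1) + a (0, - 1)) * cos x + (a (0, 1) - a (0, - 1)) * sin x = s * cos (x + \<nu>)"
    using polar_nonneg by blast
  have "eigen_sum a z = r * cos (fst z + \<mu>) + s * cos (snd z + \<nu>)" for z
    unfolding r(3)[symmetric] s(3)[symmetric] eigen_sum_def sum_unit_modes cas_unit_modes
    by (simp add: algebra_simps)
  moreover have "r\<^sup>2 = x_energy a" "s\<^sup>2 = y_energy a"
    unfolding r(2) s(2) by (simp_all add: x_energy_def y_energy_def power2_eq_square algebra_simps)
  ultimately show ?thesis using that r(1) s(1) by blast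
qed

lemma S1_eigen_sum:
  assumes "h \<in> S1 \<alpha> \<beta>"
  obtains a where "h = eigen_sum a" "x_energy a = \<alpha>\<^sup>2" "y_energy a = \<beta>\<^sup>2"
proof -
  obtain \<mu> \<nu> where h: "h = (\<lambda>(x, y). \<alpha> * cos (x + \<mu>) + \<beta> * cos (y + \<nu>))"
    using assms by (auto simp: S1_def)
  \<comment> \<open>The coefficients of (1, 0) and (-1, 0) must have sum \<alpha> cos \<mu> and
    difference -\<alpha> sin \<mu>, by the addition theorem; the y-wave is treated alike.\<close>
  define a where "a = (\<lambda>k :: int \<times> int.
      if k = (1, 0) then \<alpha> * (cos \<mu> - sin \<mu>) / 2 else if k = (- 1, 0) then \<alpha> * (cos \<mu> + sin \<mu>) / 2
      else if k = (0, 1) then \<beta> * (cos \<nu> - sin \<nu>) / 2 else \<beta> * (cos \<nu> + sin \<nu>) / 2)"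
  have "h = eigen_sum a"
    by (auto simp: h eigen_sum_def sum_unit_modes cas_unit_modes a_def cos_add field_simps)
  moreover have "2 * ((c * (u - v) / 2)\<^sup>2 + (c * (u + v) / 2)\<^sup>2) = c\<^sup>2 * (v\<^sup>2 + u\<^sup>2)" for c u v :: real
    by (simp add: power2_eq_square field_simps)
  ultimately show ?thesis
    using that[of a] by (simp add: x_energy_def y_energy_def a_def)
qed

section \<open>Fourth moment on the first eigenspace\<close>

lemma torus_integral_product:
  fixes f g :: "real \<Rightarrow> real"
  assumes "continuous_on UNIV f" "continuous_on UNIV g"
  shows "torus_integral (\<lambda>z. f (fst z) * g (snd z)) = integral {0..2 * pi} f * integral {0..2 * pi} g"
proof -
  have "continuous_on UNIV (\<lambda>z. f (fst z) * g (snd z))"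
    by (intro continuous_intros continuous_on_compose2[OF assms(1)] continuous_on_compose2[OF assms(2)]) auto
  from torus_integral_Fubini(1)[OF this] show ?thesis by simp
qed

text \<open>Over a full period only the linear terms of the antiderivatives contribute,
  \<open>x / 2\<close> and \<open>3 * x / 8\<close>; odd powers have periodic
  antiderivatives.\<close>

lemma integral_cos_powers:
  "integral {0..2 * pi} (\<lambda>x. cos (x + \<mu>)) = 0"
  "integral {0..2 * pi} (\<lambda>x. (cos (x + \<mu>))\<^sup>2) = pi"
  "integral {0..2 * pi} (\<lambda>x. (cos (x + \<mu>)) ^ 3) = 0"
  "integral {0..2 * pi} (\<lambda>x. (cos (x + \<mu>)) ^ 4) = 3 * pi / 4"
proof -
  have I: "integral {0..2 * pi} g = G (2 * pi) - G 0"
    if "\<And>x. (G has_real_derivative g x) (at x)" for G g :: "real \<Rightarrow> real"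
    by (rule integral_unique, rule fundamental_theorem_of_calculus)
      (use that in \<open>auto simp flip: has_real_derivative_iff_has_vector_derivative
          intro: has_field_derivative_at_within\<close>)
  have per: "sin (2 * pi + \<mu>) = sin \<mu>" "cos (2 * pi + \<mu>) = cos \<mu>"
    by (simp_all add: sin_add cos_add)
  have sq: "(sin (x + \<mu>))\<^sup>2 = 1 - (cos (x + \<mu>))\<^sup>2" for x by (simp add: sin_squared_eq)
  show "integral {0..2 * pi} (\<lambda>x. cos (x + \<mu>)) = 0"
    by (subst I[of "\<lambda>x. sin (x + \<mu>)"]) (auto intro!: derivative_eq_intros simp: per)
  show "integral {0..2 * pi} (\<lambda>x. (cos (x + \<mu>))\<^sup>2) = pi"
  proof (subst I[of "\<lambda>x. x / 2 + sin (x + \<mu>) * cos (x + \<mu>) / 2"])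
    show "((\<lambda>x. x / 2 + sin (x + \<mu>) * cos (x + \<mu>) / 2) has_real_derivative (cos (x + \<mu>))\<^sup>2) (at x)" for x
    proof -
      define c s where "c = cos (x + \<mu>)" "s = sin (x + \<mu>)"
      have "s * s = 1 - c\<^sup>2" using sq[of x] by (simp add: c_s_def power2_eq_square)
      then have "1 / 2 + (c * c - s * s) / 2 = c\<^sup>2" by (simp add: power2_eq_square field_simps)
      then show ?thesis
        by (auto intro!: derivative_eq_intros simp flip: c_s_def) (simp add: field_simps)
    qed
  qed (simp add: per)
  show "integral {0..2 * pi} (\<lambda>x. (cos (x + \<mu>)) ^ 3) = 0"
  proof (subst I[of "\<lambda>x. sin (x + \<mu>) - (sin (x + \<mu>)) ^ 3 / 3"])
    show "((\<lambda>x. sin (x + \<mu>) - (sin (x + \<mu>)) ^ 3 / 3) has_real_derivative (cos (x + \<mu>)) ^ 3) (at x)" for x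
    proof -
      define c s where "c = cos (x + \<mu>)" "s = sin (x + \<mu>)"
      have "s\<^sup>2 = 1 - c\<^sup>2" using sq[of x] by (simp add: c_s_def)
      then have "c - c * s\<^sup>2 = c ^ 3" by (simp only:) (simp add: eval_nat_numeral algebra_simps)
      then show ?thesis
        by (auto intro!: derivative_eq_intros simp flip: c_s_def)
    qed
  qed (simp add: per)
  show "integral {0..2 * pi} (\<lambda>x. (cos (x + \<mu>)) ^ 4) = 3 * pi / 4"
  proof (subst I[of "\<lambda>x. 3 * x / 8 + 3 / 8 * (sin (x + \<mu>) * cos (x + \<mu>)) + sin (x + \<mu>) * (cos (x + \<mu>)) ^ 3 / 4"])
    fix x
    define c s where "c = cos (x + \<mu>)" "s = sin (x + \<mu>)"
    have "3 / 8 + 3 / 8 * (c * c - s * s) + (c * c ^ 3 - s * (3 * c\<^sup>2 * s)) / 4 = c ^ 4"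
    proof -
      have ss: "s * s = 1 - c\<^sup>2" using sq[of x] by (simp add: c_s_def power2_eq_square)
      have "s * (3 * c\<^sup>2 * s) = 3 * c\<^sup>2 * (s * s)" by simp
      then show ?thesis by (simp only: ss) (simp add: eval_nat_numeral field_simps)
    qed
    then show "((\<lambda>x. 3 * x / 8 + 3 / 8 * (sin (x + \<mu>) * cos (x + \<mu>)) + sin (x + \<mu>) * (cos (x + \<mu>)) ^ 3 / 4)
        has_real_derivative (cos (x + \<mu>)) ^ 4) (at x)"
      by (auto intro!: derivative_eq_intros simp flip: c_s_def) (simp add: field_simps)
  qed (simp add: per)
qed

text \<open>Of the five binomial terms, those with odd exponents vanish. The others are grouped so
  that one summand depends on r^2 + s^2, already controlled by the enstrophy, and r^2 s^2 remains as
  new information.\<close>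

lemma torus_integral_fourth_power:
  "torus_integral (\<lambda>z. (r * cos (fst z + \<mu>) + s * cos (snd z + \<nu>)) ^ 4)
     = 3 / 2 * pi\<^sup>2 * (r\<^sup>2 + s\<^sup>2)\<^sup>2 + 3 * pi\<^sup>2 * (r\<^sup>2 * s\<^sup>2)"
proof -
  define G where "G i j z = (cos (fst z + \<mu>)) ^ i * (cos (snd z + \<nu>)) ^ j" for i j and z :: "real \<times> real"
  have cG [continuous_intros]: "continuous_on UNIV (G i j)" for i j
    unfolding G_def by (intro continuous_intros)
  have G: "torus_integral (G i j)
      = integral {0..2 * pi} (\<lambda>x. (cos (x + \<mu>)) ^ i) * integral {0..2 * pi} (\<lambda>y. (cos (y + \<nu>)) ^ j)" for i j
    unfolding G_def by (rule torus_integral_product) (auto intro!: continuous_intros)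
  have m: "torus_integral (G 4 0) = 3 * pi / 4 * (2 * pi)" "torus_integral (G 3 1) = 0"
    "torus_integral (G 2 2) = pi * pi" "torus_integral (G 1 3) = 0" "torus_integral (G 0 4) = 2 * pi * (3 * pi / 4)"
    unfolding G by (simp_all add: integral_cos_powers)
  have "(r * cos (fst z + \<mu>) + s * cos (snd z + \<nu>)) ^ 4
    = r ^ 4 * G 4 0 z + (4 * r ^ 3 * s * G 3 1 z + (6 * r\<^sup>2 * s\<^sup>2 * G 2 2 z
       + (4 * r * s ^ 3 * G 1 3 z + s ^ 4 * G 0 4 z)))" for z
    unfolding G_def by (simp add: eval_nat_numeral algebra_simps)
  then have "torus_integral (\<lambda>z. (r * cos (fst z + \<mu>) + s * cos (snd z + \<nu>)) ^ 4)
    = r ^ 4 * torus_integral (G 4 0) + (4 * r ^ 3 * s * torus_integral (G 3 1)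
       + (6 * r\<^sup>2 * s\<^sup>2 * torus_integral (G 2 2) + (4 * r * s ^ 3 * torus_integral (G 1 3)
       + s ^ 4 * torus_integral (G 0 4))))"
    by (simp add: torus_integral_add torus_integral_cmult continuous_intros)
  also have "\<dots> = 3 / 2 * pi\<^sup>2 * (r\<^sup>2 + s\<^sup>2)\<^sup>2 + 3 * pi\<^sup>2 * (r\<^sup>2 * s\<^sup>2)"
    unfolding m by (simp add: eval_nat_numeral field_simps)
  finally show ?thesis .
qed

section \<open>Stability\<close>

text \<open>Makes (u^2 + u |u|) / 2, the square of the positive part of u, a C^1 function; it serves
  as the switch in the truncation.\<close>

lemma has_real_derivative_mult_abs:
  "((\<lambda>u :: real. u * \<bar>u\<bar>) has_real_derivative 2 * \<bar>u\<bar>) (at u)"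
proof (cases u "0 :: real" rule: linorder_cases)
  case less
  have "((\<lambda>u. - (u * u)) has_real_derivative 2 * \<bar>u\<bar>) (at u)"
    using less by (auto intro!: derivative_eq_intros)
  then show ?thesis
    by (rule has_field_derivative_transform_within_open[of _ _ _ "{..<0}"]) (use less in auto)
next
  case equal
  have "((\<lambda>y :: real. \<bar>y\<bar>) \<longlongrightarrow> 0) (at 0)"
    by (auto intro!: tendsto_eq_intros)
  then have "((\<lambda>y :: real. (y * \<bar>y\<bar> - 0) / (y - 0)) \<longlongrightarrow> 0) (at 0)"
    by (rule Lim_transform_eventually) (auto simp: eventually_at_filter)
  then show ?thesis using equal by (simp add: has_field_derivative_iff)
next
  case greater
  have "((\<lambda>u. u * u) has_real_derivative 2 * \<bar>u\<bar>) (at u)"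
    using greater by (auto intro!: derivative_eq_intros)
  then show ?thesis
    by (rule has_field_derivative_transform_within_open[of _ _ _ "{0<..}"]) (use greater in auto)
qed

text \<open>
  The function \<open>F\<close> continues $s^4$ linearly beyond $|s| = 2$: the vorticity is close to the first
  eigenspace only in $L^2$, which does not control the fourth moment itself.
\<close>

lemma truncated_fourth_power:
  obtains F F' :: "real \<Rightarrow> real" where "\<And>s. (F has_real_derivative F' s) (at s)" "continuous_on UNIV F'"
    "\<And>s t. \<bar>F s - F t\<bar> \<le> 32 * \<bar>s - t\<bar>" "\<And>s. \<bar>s\<bar> \<le> 2 \<Longrightarrow> F s = s ^ 4"
proof -
  define m :: "real \<Rightarrow> real" where "m u = (u\<^sup>2 + u * \<bar>u\<bar>) / 2" for u
  define m' :: "real \<Rightarrow> real" where "m' u = u + \<bar>u\<bar>" for u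
  \<comment> \<open>(s - 2)^2 (s^2 + 4 s + 12) is s^4 minus its tangent 32 s - 48 at 2, so the first
    correction replaces s^4 by that tangent for s > 2. The second is its mirror image at -2.\<close>
  define F :: "real \<Rightarrow> real" where
    "F s = s ^ 4 - m (s - 2) * (s\<^sup>2 + 4 * s + 12) - m (- s - 2) * (s\<^sup>2 - 4 * s + 12)" for s
  define F' :: "real \<Rightarrow> real" where
    "F' s = 4 * s ^ 3 - (m' (s - 2) * (s\<^sup>2 + 4 * s + 12) + m (s - 2) * (2 * s + 4))
       - (- m' (- s - 2) * (s\<^sup>2 - 4 * s + 12) + m (- s - 2) * (2 * s - 4))" for s
  have Dm: "(m has_real_derivative m' u) (at u)" for u
  proof -
    have "((\<lambda>u :: real. u\<^sup>2) has_real_derivative 2 * u) (at u)"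
      by (auto intro!: derivative_eq_intros)
    from DERIV_cdivide[OF DERIV_add[OF this has_real_derivative_mult_abs], of 2]
    show ?thesis by (simp add: m_def[abs_def] m'_def add_divide_distrib)
  qed
  have Dm1: "((\<lambda>s. m (s - 2)) has_real_derivative m' (s - 2)) (at s)" for s
    by (rule DERIV_cong[OF DERIV_chain2[OF Dm]]) (auto intro!: derivative_eq_intros)
  have Dm2: "((\<lambda>s. m (- s - 2)) has_real_derivative - m' (- s - 2)) (at s)" for s
    by (rule DERIV_cong[OF DERIV_chain2[OF Dm]]) (auto intro!: derivative_eq_intros)
  have D: "(F has_real_derivative F' s) (at s)" for s
    unfolding F_def F'_def by (auto intro!: derivative_eq_intros Dm1 Dm2)
  have m0: "m u = 0" "m' u = 0" if "u \<le> 0" for u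
    using that by (auto simp: m_def m'_def power2_eq_square)
  have m1: "m u = u\<^sup>2" "m' u = 2 * u" if "0 \<le> u" for u
    using that by (auto simp: m_def m'_def power2_eq_square)
  have bound: "\<bar>F' s\<bar> \<le> 32" for s
  proof -
    consider "2 \<le> s" | "s \<le> - 2" | "\<bar>s\<bar> \<le> 2" by linarith
    then show ?thesis
    proof cases
      case 1
      then have "F' s = 32"
        unfolding F'_def by (simp add: m0 m1) (simp add: eval_nat_numeral algebra_simps)
      then show ?thesis by simp
    next
      case 2
      then have "F' s = - 32"
        unfolding F'_def by (simp add: m0 m1) (simp add: eval_nat_numeral algebra_simps)
      then show ?thesis by simp
    next
      case 3
      then have "F' s = 4 * s ^ 3" unfolding F'_def by (simp add: m0)
      moreover have "\<bar>s\<bar> ^ 3 \<le> 2 ^ 3" using 3 by (intro power_mono) auto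
      ultimately show ?thesis by (simp add: abs_mult power_abs)
    qed
  qed
  have "\<bar>F s - F t\<bar> \<le> 32 * \<bar>s - t\<bar>" for s t
    using field_differentiable_bound[of UNIV F F' 32 s t] D bound by auto
  moreover have "F s = s ^ 4" if "\<bar>s\<bar> \<le> 2" for s
    using that unfolding F_def by (simp add: m0)
  moreover have "continuous_on UNIV F'"
    unfolding F'_def m_def m'_def by (intro continuous_intros) auto
  ultimately show ?thesis using that D by blast
qed

text \<open>The formula is exact for the projection \<open>v\<close> onto the first eigenspace,
  whose values stay where F is the fourth power. Replacing w by \<open>v\<close> costs the Lipschitz
  constant 32 times the L^1 norm of the high part, and Cauchy-Schwarz against the constant 1, of
  norm 2 pi, gives 64 pi.\<close>

lemma truncated_fourth_moment:
  fixes w :: "real \<times> real \<Rightarrow> real"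
  defines "A \<equiv> x_energy (fourier_coef w)" and "B \<equiv> y_energy (fourier_coef w)"
  assumes w: "continuous_on UNIV w" and le: "A + B \<le> 2"
    and Fc: "continuous_on UNIV F"
    and Lip: "\<And>s t. \<bar>F s - F t\<bar> \<le> 32 * \<bar>s - t\<bar>" and F4: "\<And>s. \<bar>s\<bar> \<le> 2 \<Longrightarrow> F s = s ^ 4"
  shows "\<bar>torus_integral (\<lambda>z. F (w z)) - (3 / 2 * pi\<^sup>2 * (A + B)\<^sup>2 + 3 * pi\<^sup>2 * (A * B))\<bar>
     \<le> 64 * pi * torus_L2_norm (high_part w)"
proof -
  obtain r s \<mu> \<nu> where rs: "0 \<le> r" "0 \<le> s" "r\<^sup>2 = A" "s\<^sup>2 = B"
    and e: "\<And>z. eigen_sum (fourier_coef w) z = r * cos (fst z + \<mu>) + s * cos (snd z + \<nu>)"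
    using eigen_sum_polar A_def B_def by metis
  define v where "v = eigen_sum (fourier_coef w)"
  have v: "continuous_on UNIV v" unfolding v_def by (intro continuous_intros)
  have h: "continuous_on UNIV (high_part w)"
    unfolding high_part_def using w by (intro continuous_intros)
  have Fw: "continuous_on UNIV (\<lambda>z. F (w z))" "continuous_on UNIV (\<lambda>z. F (v z))"
    by (auto intro: continuous_on_compose2[OF Fc] w v)
  \<comment> \<open>(r + s)^2 \<le> 2 (r^2 + s^2) \<le> 4, which is why the truncation starts at
    2.\<close>
  have "(r + s)\<^sup>2 \<le> 2\<^sup>2"
    using le rs zero_le_power2[of "r - s"] by (simp add: power2_eq_square algebra_simps)
  then have "r + s \<le> 2" by (rule power2_le_imp_le) simp
  moreover have "\<bar>v z\<bar> \<le> r + s" for z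
  proof -
    have "\<bar>r * cos (fst z + \<mu>)\<bar> \<le> r" "\<bar>s * cos (snd z + \<nu>)\<bar> \<le> s"
      using rs by (auto simp: abs_mult intro!: mult_left_le)
    then show ?thesis unfolding v_def e by linarith
  qed
  ultimately have "F (v z) = (r * cos (fst z + \<mu>) + s * cos (snd z + \<nu>)) ^ 4" for z
    unfolding e[symmetric] v_def[symmetric] by (intro F4) (meson order.trans)
  then have Fv: "torus_integral (\<lambda>z. F (v z)) = 3 / 2 * pi\<^sup>2 * (A + B)\<^sup>2 + 3 * pi\<^sup>2 * (A * B)"
    using torus_integral_fourth_power[of r \<mu> s \<nu>] by (simp add: rs)
  define I where "I = torus_integral (\<lambda>z. \<bar>high_part w z\<bar> * 1)"
  have I: "I \<le> torus_L2_norm (high_part w) * (2 * pi)"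
  proof (rule power2_le_imp_le)
    have "I\<^sup>2 \<le> torus_integral (\<lambda>z. \<bar>high_part w z\<bar>\<^sup>2) * torus_integral (\<lambda>z. 1\<^sup>2)"
      unfolding I_def using h by (intro torus_integral_Cauchy_Schwarz continuous_intros)
    also have "\<dots> = (torus_L2_norm (high_part w) * (2 * pi))\<^sup>2"
      using torus_integral_const[of 1] torus_integral_nonneg[of "\<lambda>z. (high_part w z)\<^sup>2"]
      by (simp add: torus_L2_norm_def power_mult_distrib)
    finally show "I\<^sup>2 \<le> (torus_L2_norm (high_part w) * (2 * pi))\<^sup>2" .
    show "0 \<le> torus_L2_norm (high_part w) * (2 * pi)"
      using torus_integral_nonneg[of "\<lambda>z. (high_part w z)\<^sup>2"] by (simp add: torus_L2_norm_def)
  qed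
  have le: "F (w z) - F (v z) \<le> 32 * (\<bar>high_part w z\<bar> * 1)" "F (v z) - F (w z) \<le> 32 * (\<bar>high_part w z\<bar> * 1)" for z
    using Lip[of "w z" "v z"] by (auto simp: high_part_def v_def)
  have "torus_integral (\<lambda>z. F (w z) - F (v z)) \<le> torus_integral (\<lambda>z. 32 * (\<bar>high_part w z\<bar> * 1))"
    "torus_integral (\<lambda>z. F (v z) - F (w z)) \<le> torus_integral (\<lambda>z. 32 * (\<bar>high_part w z\<bar> * 1))"
    using le Fw h by (auto intro!: torus_integral_mono continuous_intros)
  then have "\<bar>torus_integral (\<lambda>z. F (w z)) - torus_integral (\<lambda>z. F (v z))\<bar> \<le> 32 * I"
    unfolding I_def torus_integral_cmult using Fw by (simp add: torus_integral_diff)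
  then show ?thesis unfolding Fv using I by (simp add: mult_ac)
qed

lemma square_diff_le:
  fixes a c \<epsilon> :: real
  assumes "\<bar>a - c\<bar> \<le> \<epsilon>" "\<bar>a\<bar> \<le> 1" "\<epsilon> \<le> 1"
  shows "\<bar>c\<^sup>2 - a\<^sup>2\<bar> \<le> 3 * \<epsilon>"
proof -
  have "\<bar>c\<^sup>2 - a\<^sup>2\<bar> = \<bar>c + a\<bar> * \<bar>a - c\<bar>"
    by (simp add: abs_mult[symmetric] power2_eq_square algebra_simps abs_minus_commute)
  also have "\<dots> \<le> 3 * \<epsilon>"
    using assms by (intro mult_mono) auto
  finally show ?thesis .
qed

section \<open>Distance to the orbit in terms of the amplitudes\<close>

lemma S1_nonempty: "S1 \<alpha> \<beta> \<noteq> {}"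
  by (auto simp: S1_def)

lemma bdd_below_torus_L2_norm: "bdd_below ((\<lambda>h. torus_L2_norm (\<lambda>z. g z - h z)) ` S)"
  by (rule bdd_belowI[of _ 0]) (auto simp: torus_L2_norm_def torus_integral_nonneg)

text \<open>By orthogonality the squared distance from w to a nearly closest h is the squared norm
  of the high part plus 4 pi^2 times the squared differences of the coefficients, so each of these
  pieces is small separately.\<close>

lemma torus_L2_dist_S1_less:
  assumes w: "continuous_on UNIV w" and circle: "\<alpha>\<^sup>2 + \<beta>\<^sup>2 = 1" and \<epsilon>: "\<epsilon> \<le> 1"
    and d: "torus_L2_dist w (S1 \<alpha> \<beta>) < \<epsilon>"
  shows "torus_L2_norm (high_part w) < \<epsilon>"
    and "\<bar>x_energy (fourier_coef w) - \<alpha>\<^sup>2\<bar> \<le> 12 * \<epsilon>" and "\<bar>y_energy (fourier_coef w) - \<beta>\<^sup>2\<bar> \<le> 12 * \<epsilon>"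
proof -
  obtain h where h: "h \<in> S1 \<alpha> \<beta>" "torus_L2_norm (\<lambda>z. w z - h z) < \<epsilon>"
    using d unfolding torus_L2_dist_def cINF_less_iff[OF S1_nonempty bdd_below_torus_L2_norm] by blast
  obtain a where a: "h = eigen_sum a" "x_energy a = \<alpha>\<^sup>2" "y_energy a = \<beta>\<^sup>2"
    using S1_eigen_sum[OF h(1)] .
  define N where "N = torus_integral (\<lambda>z. (high_part w z)\<^sup>2)"
  define c where "c = fourier_coef w"
  have N0: "0 \<le> N" unfolding N_def by (rule torus_integral_nonneg) simp
  have \<epsilon>0: "0 < \<epsilon>"
    using h(2) torus_integral_nonneg[of "\<lambda>z. (w z - h z)\<^sup>2"] unfolding torus_L2_norm_def
    by (meson le_less_trans real_sqrt_ge_zero zero_le_power2)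
  have dist: "sqrt (N + 4 * pi\<^sup>2 * (\<Sum>k\<in>unit_modes. (a k - c k)\<^sup>2)) < \<epsilon>"
    using h(2) unfolding torus_L2_norm_def a(1) torus_integral_eigen_distance[OF w] N_def c_def .
  have sum0: "0 \<le> 4 * pi\<^sup>2 * (\<Sum>k\<in>unit_modes. (a k - c k)\<^sup>2)"
    by (intro mult_nonneg_nonneg sum_nonneg) auto
  then have "sqrt N \<le> sqrt (N + 4 * pi\<^sup>2 * (\<Sum>k\<in>unit_modes. (a k - c k)\<^sup>2))"
    by simp
  then show "torus_L2_norm (high_part w) < \<epsilon>"
    using dist unfolding torus_L2_norm_def N_def by (rule le_less_trans)
  have close: "\<bar>a k - c k\<bar> \<le> \<epsilon>" if "k \<in> unit_modes" for k
  proof -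
    have "1 \<le> 4 * pi\<^sup>2" using pi_ge_two power_mono[of 2 pi 2] by simp
    have "(a k - c k)\<^sup>2 \<le> (\<Sum>k\<in>unit_modes. (a k - c k)\<^sup>2)"
      using that by (intro member_le_sum) auto
    also have "\<dots> \<le> 4 * pi\<^sup>2 * (\<Sum>k\<in>unit_modes. (a k - c k)\<^sup>2)"
      using \<open>1 \<le> 4 * pi\<^sup>2\<close> mult_right_mono[of 1 "4 * pi\<^sup>2" "\<Sum>k\<in>unit_modes. (a k - c k)\<^sup>2"]
      by (simp add: sum_nonneg)
    also have "\<dots> \<le> N + 4 * pi\<^sup>2 * (\<Sum>k\<in>unit_modes. (a k - c k)\<^sup>2)"
      using N0 by simp
    finally have "sqrt ((a k - c k)\<^sup>2) \<le> sqrt (N + 4 * pi\<^sup>2 * (\<Sum>k\<in>unit_modes. (a k - c k)\<^sup>2))"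
      by (rule real_sqrt_le_mono)
    then show ?thesis using dist by simp
  qed
  have le1: "\<bar>a (1, 0)\<bar> \<le> 1" "\<bar>a (- 1, 0)\<bar> \<le> 1" "\<bar>a (0, 1)\<bar> \<le> 1" "\<bar>a (0, - 1)\<bar> \<le> 1"
  proof -
    have "2 * ((a (1, 0))\<^sup>2 + (a (- 1, 0))\<^sup>2) + 2 * ((a (0, 1))\<^sup>2 + (a (0, - 1))\<^sup>2) = 1"
      using a(2,3) circle by (simp add: x_energy_def y_energy_def)
    then have "(a (1, 0))\<^sup>2 \<le> 1" "(a (- 1, 0))\<^sup>2 \<le> 1" "(a (0, 1))\<^sup>2 \<le> 1" "(a (0, - 1))\<^sup>2 \<le> 1"
      using zero_le_power2[of "a (1, 0)"] zero_le_power2[of "a (- 1, 0)"]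
        zero_le_power2[of "a (0, 1)"] zero_le_power2[of "a (0, - 1)"]
      unfolding distrib_left by linarith+
    then show "\<bar>a (1, 0)\<bar> \<le> 1" "\<bar>a (- 1, 0)\<bar> \<le> 1" "\<bar>a (0, 1)\<bar> \<le> 1" "\<bar>a (0, - 1)\<bar> \<le> 1"
      by (simp_all add: abs_square_le_1)
  qed
  have "(1, 0) \<in> unit_modes" "(- 1, 0) \<in> unit_modes" "(0, 1) \<in> unit_modes" "(0, - 1) \<in> unit_modes"
    by (simp_all add: unit_modes_def)
  \<comment> \<open>Each squared coefficient is off by at most 3 \<epsilon>; each amplitude squared
    is twice the sum of two of them, hence the 12.\<close>
  note sq = this[THEN close, THEN square_diff_le, OF _ \<epsilon>]
  show "\<bar>x_energy (fourier_coef w) - \<alpha>\<^sup>2\<bar> \<le> 12 * \<epsilon>" "\<bar>y_energy (fourier_coef w) - \<beta>\<^sup>2\<bar> \<le> 12 * \<epsilon>"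
    using sq(1)[OF le1(1)] sq(2)[OF le1(2)] sq(3)[OF le1(3)] sq(4)[OF le1(4)]
    unfolding a(2)[symmetric] a(3)[symmetric] c_def[symmetric] x_energy_def y_energy_def distrib_left by linarith+
qed

text \<open>The element of the orbit is chosen with the phases of the projection of w, a negative
  \<alpha> or \<beta> being absorbed by a shift of pi. It then differs from the projection only
  through the amplitudes, uniformly by at most \<delta>.\<close>

lemma torus_L2_dist_S1_le:
  assumes w: "continuous_on UNIV w"
  shows "torus_L2_dist w (S1 \<alpha> \<beta>) \<le> sqrt 2 * torus_L2_norm (high_part w)
     + 12 * (\<bar>sqrt (x_energy (fourier_coef w)) - \<bar>\<alpha>\<bar>\<bar> + \<bar>sqrt (y_energy (fourier_coef w)) - \<bar>\<beta>\<bar>\<bar>)"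
proof -
  define \<delta> where "\<delta> = \<bar>sqrt (x_energy (fourier_coef w)) - \<bar>\<alpha>\<bar>\<bar> + \<bar>sqrt (y_energy (fourier_coef w)) - \<bar>\<beta>\<bar>\<bar>"
  define v where "v = eigen_sum (fourier_coef w)"
  obtain r s \<mu> \<nu> where rs: "0 \<le> r" "0 \<le> s" "r\<^sup>2 = x_energy (fourier_coef w)" "s\<^sup>2 = y_energy (fourier_coef w)"
    and v: "\<And>z. v z = r * cos (fst z + \<mu>) + s * cos (snd z + \<nu>)"
    using eigen_sum_polar v_def by metis
  have \<delta>: "\<delta> = \<bar>r - \<bar>\<alpha>\<bar>\<bar> + \<bar>s - \<bar>\<beta>\<bar>\<bar>"
    using rs by (simp add: \<delta>_def flip: rs(3,4))
  have phase: "\<exists>\<mu>'. \<forall>x. a * cos (x + \<mu>') = \<bar>a\<bar> * cos (x + \<mu>)" for a \<mu> :: real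
  proof (cases "0 \<le> a")
    case True
    then show ?thesis by auto
  next
    case False
    have "cos (x + (\<mu> + pi)) = - cos (x + \<mu>)" for x
      using cos_periodic_pi[of "x + \<mu>"] by (simp add: algebra_simps)
    then show ?thesis using False by (intro exI[of _ "\<mu> + pi"]) simp
  qed
  obtain \<mu>' \<nu>' where p: "\<And>x. \<alpha> * cos (x + \<mu>') = \<bar>\<alpha>\<bar> * cos (x + \<mu>)" "\<And>x. \<beta> * cos (x + \<nu>') = \<bar>\<beta>\<bar> * cos (x + \<nu>)"
    using phase by metis
  define h where "h = (\<lambda>(x, y). \<alpha> * cos (x + \<mu>') + \<beta> * cos (y + \<nu>'))"
  have hS: "h \<in> S1 \<alpha> \<beta>" unfolding S1_def h_def by blast
  have h: "h z = \<bar>\<alpha>\<bar> * cos (fst z + \<mu>) + \<bar>\<beta>\<bar> * cos (snd z + \<nu>)" for z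
    unfolding h_def p by (simp add: case_prod_unfold)
  have vh: "\<bar>v z - h z\<bar> \<le> \<delta>" for z
  proof -
    have "v z - h z = (r - \<bar>\<alpha>\<bar>) * cos (fst z + \<mu>) + (s - \<bar>\<beta>\<bar>) * cos (snd z + \<nu>)"
      by (simp add: v h algebra_simps)
    moreover have "\<bar>(r - \<bar>\<alpha>\<bar>) * cos (fst z + \<mu>)\<bar> \<le> \<bar>r - \<bar>\<alpha>\<bar>\<bar>" "\<bar>(s - \<bar>\<beta>\<bar>) * cos (snd z + \<nu>)\<bar> \<le> \<bar>s - \<bar>\<beta>\<bar>\<bar>"
      by (auto simp: abs_mult intro!: mult_left_le)
    ultimately show ?thesis unfolding \<delta> by linarith
  qed
  have c: "continuous_on UNIV (high_part w)" "continuous_on UNIV (\<lambda>z. w z - h z)"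
    unfolding high_part_def h using w by (auto intro!: continuous_intros)
  have "torus_integral (\<lambda>z. (w z - h z)\<^sup>2) \<le> torus_integral (\<lambda>z. 2 * (high_part w z)\<^sup>2 + 2 * \<delta>\<^sup>2)"
  proof (rule torus_integral_mono)
    fix z
    have "(v z - h z)\<^sup>2 \<le> \<delta>\<^sup>2" using vh[of z] by (metis abs_ge_zero power2_abs power_mono)
    moreover have "w z - h z = high_part w z + (v z - h z)"
      by (simp add: high_part_def v_def)
    then have "(w z - h z)\<^sup>2 \<le> 2 * (high_part w z)\<^sup>2 + 2 * (v z - h z)\<^sup>2"
      using zero_le_power2[of "high_part w z - (v z - h z)"]
      by (simp only:) (simp add: power2_eq_square algebra_simps)
    ultimately show "(w z - h z)\<^sup>2 \<le> 2 * (high_part w z)\<^sup>2 + 2 * \<delta>\<^sup>2" by linarith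
  qed (use c in \<open>auto intro!: continuous_intros\<close>)
  also have "\<dots> = 2 * torus_integral (\<lambda>z. (high_part w z)\<^sup>2) + 8 * pi\<^sup>2 * \<delta>\<^sup>2"
    using c by (simp add: torus_integral_add torus_integral_cmult torus_integral_const continuous_intros)
  finally have "torus_L2_norm (\<lambda>z. w z - h z) \<le> sqrt (2 * torus_integral (\<lambda>z. (high_part w z)\<^sup>2) + 8 * pi\<^sup>2 * \<delta>\<^sup>2)"
    unfolding torus_L2_norm_def by (rule real_sqrt_le_mono)
  also have "\<dots> \<le> sqrt (2 * torus_integral (\<lambda>z. (high_part w z)\<^sup>2)) + sqrt (8 * pi\<^sup>2 * \<delta>\<^sup>2)"
    by (rule sqrt_add_le_add_sqrt) (auto simp: torus_integral_nonneg)
  \<comment> \<open>pi < 4 gives 8 pi^2 < 128 < 144.\<close>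
  also have "sqrt (8 * pi\<^sup>2 * \<delta>\<^sup>2) \<le> 12 * \<delta>"
  proof (rule real_le_lsqrt)
    have "pi\<^sup>2 \<le> 4\<^sup>2" using pi_less_4 by (intro power_mono) auto
    then have "pi\<^sup>2 * \<delta>\<^sup>2 \<le> 16 * \<delta>\<^sup>2" by (intro mult_right_mono) auto
    then have "8 * (pi\<^sup>2 * \<delta>\<^sup>2) \<le> 144 * \<delta>\<^sup>2"
      using zero_le_power2[of \<delta>] by linarith
    then show "8 * pi\<^sup>2 * \<delta>\<^sup>2 \<le> (12 * \<delta>)\<^sup>2"
      by (simp add: power_mult_distrib)
  qed (auto simp: \<delta>)
  finally have "torus_L2_norm (\<lambda>z. w z - h z) \<le> sqrt 2 * torus_L2_norm (high_part w) + 12 * \<delta>"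
    by (simp add: torus_L2_norm_def real_sqrt_mult)
  moreover have "torus_L2_dist w (S1 \<alpha> \<beta>) \<le> torus_L2_norm (\<lambda>z. w z - h z)"
    unfolding torus_L2_dist_def by (rule cINF_lower[OF bdd_below_torus_L2_norm hS])
  ultimately show ?thesis unfolding \<delta>_def by linarith
qed

text \<open>The interface between the flow and elementary inequalities: A and B are the squared
  amplitudes in x and in y. The bounds for all times come from conservation laws; the unsquared
  bound at time 0 supplies the initial sign of A - B. All error constants are rounded up to
  300.\<close>

lemma euler_amplitudes:
  assumes \<omega>: "smooth_euler_solution \<omega>" and circle: "\<alpha>\<^sup>2 + \<beta>\<^sup>2 = 1"
    and \<epsilon>: "0 < \<epsilon>" "\<epsilon> < 1 / 300" and d: "torus_L2_dist (\<omega> 0) (S1 \<alpha> \<beta>) < \<epsilon>"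
  obtains A B where "continuous_on UNIV A" "continuous_on UNIV B"
    "\<And>t :: real. 0 \<le> A t" "\<And>t :: real. 0 \<le> B t" "\<And>t. \<bar>A t + B t - 1\<bar> \<le> 300 * \<epsilon>"
    "\<And>t. \<bar>(A t - B t)\<^sup>2 - (\<alpha>\<^sup>2 - \<beta>\<^sup>2)\<^sup>2\<bar> \<le> 300 * \<epsilon>"
    "\<bar>(A 0 - B 0) - (\<alpha>\<^sup>2 - \<beta>\<^sup>2)\<bar> \<le> 300 * \<epsilon>"
    "\<And>t. torus_L2_dist (\<omega> t) (S1 \<alpha> \<beta>)
       \<le> 3 * \<epsilon> + 12 * (\<bar>sqrt (A t) - \<bar>\<alpha>\<bar>\<bar> + \<bar>sqrt (B t) - \<bar>\<beta>\<bar>\<bar>)"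
proof -
  obtain wt where cW: "continuous_on UNIV (\<lambda>(t, z). \<omega> t z)" and c: "\<And>t. continuous_on UNIV (\<omega> t)"
    using \<omega> by (rule smooth_euler_solutionE) (metis C1_torus_cont(1))
  obtain \<psi> px py where \<psi>: "\<And>t. torus_potential (\<omega> t) (\<psi> t) (px t) (py t)"
    and energy: "\<And>t. torus_integral (\<lambda>z. \<psi> t z * \<omega> t z) = torus_integral (\<lambda>z. \<psi> 0 z * \<omega> 0 z)"
    using energy_conserved[OF \<omega>] by blast
  have "((\<lambda>s :: real. s\<^sup>2) has_real_derivative 2 * s) (at s)" for s
    by (auto intro!: derivative_eq_intros)
  from casimir_conserved[OF \<omega> this]
  have enstrophy: "torus_integral (\<lambda>z. (\<omega> t z)\<^sup>2) = torus_integral (\<lambda>z. (\<omega> 0 z)\<^sup>2)" for t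
    by (auto intro!: continuous_intros)
  obtain F F' :: "real \<Rightarrow> real" where F: "\<And>s. (F has_real_derivative F' s) (at s)" "continuous_on UNIV F'"
    "\<And>s t. \<bar>F s - F t\<bar> \<le> 32 * \<bar>s - t\<bar>" "\<And>s. \<bar>s\<bar> \<le> 2 \<Longrightarrow> F s = s ^ 4"
    using truncated_fourth_power by blast
  have Fc: "continuous_on UNIV F"
    using F(1) by (meson DERIV_isCont continuous_at_imp_continuous_on)
  note casimir = casimir_conserved[OF \<omega> F(1,2)]
  define A where "A t = x_energy (fourier_coef (\<omega> t))" for t
  define B where "B t = y_energy (fourier_coef (\<omega> t))" for t
  define N where "N t = torus_L2_norm (high_part (\<omega> t))" for t
  have AB0: "0 \<le> A t" "0 \<le> B t" for t by (simp_all add: A_def B_def x_energy_def y_energy_def)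
  have N0: "0 \<le> N t" and N2: "(N t)\<^sup>2 = torus_integral (\<lambda>z. (high_part (\<omega> t) z)\<^sup>2)" for t
    by (simp_all add: N_def torus_L2_norm_def torus_integral_nonneg)
  have init: "N 0 < \<epsilon>" "\<bar>A 0 - \<alpha>\<^sup>2\<bar> \<le> 12 * \<epsilon>" "\<bar>B 0 - \<beta>\<^sup>2\<bar> \<le> 12 * \<epsilon>"
    using torus_L2_dist_S1_less[OF c circle _ d] \<epsilon> by (simp_all add: N_def A_def B_def)
  \<comment> \<open>With Q enstrophy minus energy, (N t)^2 \<le> 2 Q(t) = 2 Q(0) \<le> 2 (N 0)^2:
    the two halves of the gap estimate are used at different times.\<close>
  have NN: "(N t)\<^sup>2 \<le> 2 * \<epsilon>\<^sup>2" for t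
  proof -
    have "(N t)\<^sup>2 \<le> 2 * (N 0)\<^sup>2"
      using enstrophy_minus_energy_bounds(1)[OF \<psi>, of t] enstrophy_minus_energy_bounds(2)[OF \<psi>, of 0]
      unfolding N2 energy[of t] enstrophy[of t] right_diff_distrib by linarith
    also have "\<dots> \<le> 2 * \<epsilon>\<^sup>2" using init(1) N0[of 0] by (simp add: power_mono)
    finally show ?thesis .
  qed
  have Nle: "2 * N t \<le> 3 * \<epsilon>" for t
  proof (rule power2_le_imp_le)
    have "(2 * N t)\<^sup>2 = 4 * (N t)\<^sup>2" by (simp add: power_mult_distrib)
    also have "\<dots> \<le> 9 * \<epsilon>\<^sup>2" using NN[of t] zero_le_power2[of \<epsilon>] by linarith
    finally show "(2 * N t)\<^sup>2 \<le> (3 * \<epsilon>)\<^sup>2" by (simp add: power_mult_distrib)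
  qed (use \<epsilon> in simp)
  have total: "torus_integral (\<lambda>z. (\<omega> t z)\<^sup>2) = (N t)\<^sup>2 + 2 * pi\<^sup>2 * (A t + B t)" for t
    unfolding N2 torus_integral_high_part[OF c] A_def B_def sum_unit_modes_squares[symmetric] by simp
  \<comment> \<open>The error is in fact of order \<epsilon>^2; it is weakened because the initial
    error in A + B is linear anyway.\<close>
  have S0: "\<bar>(A t + B t) - (A 0 + B 0)\<bar> \<le> \<epsilon>" for t
  proof -
    define y where "y = (A t + B t) - (A 0 + B 0)"
    have "2 * pi\<^sup>2 * y = (N 0)\<^sup>2 - (N t)\<^sup>2"
      using total[of t] total[of 0] enstrophy[of t] by (simp add: y_def algebra_simps)
    moreover have "\<bar>(N 0)\<^sup>2 - (N t)\<^sup>2\<bar> \<le> 2 * \<epsilon>\<^sup>2"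
      using NN[of 0] NN[of t] zero_le_power2[of "N 0"] zero_le_power2[of "N t"] by linarith
    ultimately have "2 * pi\<^sup>2 * \<bar>y\<bar> \<le> 2 * \<epsilon>\<^sup>2"
      by (metis abs_mult abs_of_nonneg mult_nonneg_nonneg zero_le_numeral zero_le_power2)
    moreover have "2 * \<bar>y\<bar> \<le> 2 * pi\<^sup>2 * \<bar>y\<bar>"
      using pi_ge_two power_mono[of 1 pi 2] by (intro mult_right_mono) auto
    moreover have "\<epsilon>\<^sup>2 \<le> \<epsilon>" using \<epsilon> by (simp add: power2_eq_square mult_left_le_one_le)
    ultimately have "2 * \<bar>y\<bar> \<le> 2 * \<epsilon>"
      by (meson mult_left_mono order.trans zero_le_numeral)
    then show ?thesis by (simp add: y_def)
  qed
  have S: "\<bar>A t + B t - 1\<bar> \<le> 25 * \<epsilon>" for t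
    using S0[of t] init(2,3) circle by linarith
  then have S2: "A t + B t \<le> 2" for t using S[of t] \<epsilon> by linarith
  have SS: "\<bar>(A t + B t)\<^sup>2 - (A 0 + B 0)\<^sup>2\<bar> \<le> 4 * \<epsilon>" for t
  proof -
    have "\<bar>(A t + B t)\<^sup>2 - (A 0 + B 0)\<^sup>2\<bar> = \<bar>(A t + B t) + (A 0 + B 0)\<bar> * \<bar>(A t + B t) - (A 0 + B 0)\<bar>"
      by (simp add: abs_mult[symmetric] power2_eq_square algebra_simps)
    also have "\<dots> \<le> 4 * \<epsilon>"
      using S0[of t] S2[of t] S2[of 0] AB0[of t] AB0[of 0] by (intro mult_mono) auto
    finally show ?thesis .
  qed
  \<comment> \<open>The two moment errors add up to 192 pi \<epsilon>; division by pi^2 with pi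
    \<ge> 2 leaves 96 \<epsilon>. The change of (A + B)^2 adds 6 \<epsilon>, and a third of the
    total is 34 \<epsilon>.\<close>
  have P: "\<bar>A t * B t - A 0 * B 0\<bar> \<le> 34 * \<epsilon>" for t
  proof -
    let ?q = "\<lambda>t. 3 / 2 * pi\<^sup>2 * (A t + B t)\<^sup>2 + 3 * pi\<^sup>2 * (A t * B t)"
    have q: "\<bar>torus_integral (\<lambda>z. F (\<omega> t z)) - ?q t\<bar> \<le> 64 * pi * N t" for t
      using truncated_fourth_moment[OF c _ Fc F(3,4)] S2 unfolding A_def B_def N_def by blast
    have piN: "64 * pi * N s \<le> 96 * (pi * \<epsilon>)" for s
      using mult_left_mono[OF Nle[of s], of "32 * pi"] by simp
    have "\<bar>?q t - ?q 0\<bar> \<le> 192 * (pi * \<epsilon>)"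
      using q[of t] q[of 0] casimir[of t] piN[of t] piN[of 0] by linarith
    moreover have "?q t - ?q 0 = pi\<^sup>2 * (3 / 2 * ((A t + B t)\<^sup>2 - (A 0 + B 0)\<^sup>2) + 3 * (A t * B t - A 0 * B 0))"
      by (simp add: algebra_simps)
    moreover define y where "y = 3 / 2 * ((A t + B t)\<^sup>2 - (A 0 + B 0)\<^sup>2) + 3 * (A t * B t - A 0 * B 0)"
    ultimately have "pi\<^sup>2 * \<bar>y\<bar> \<le> 192 * (pi * \<epsilon>)"
      by (simp add: abs_mult)
    then have "pi * \<bar>y\<bar> \<le> 192 * \<epsilon>"
      by (simp add: power2_eq_square mult_ac)
    moreover have "2 * \<bar>y\<bar> \<le> pi * \<bar>y\<bar>"
      using pi_ge_two by (intro mult_right_mono) auto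
    ultimately have "\<bar>y\<bar> \<le> 96 * \<epsilon>"
      by linarith
    then have "\<bar>3 / 2 * ((A t + B t)\<^sup>2 - (A 0 + B 0)\<^sup>2) + 3 * (A t * B t - A 0 * B 0)\<bar> \<le> 96 * \<epsilon>"
      unfolding y_def .
    then show ?thesis using SS[of t] unfolding right_diff_distrib by linarith
  qed
  define D where "D = \<alpha>\<^sup>2 - \<beta>\<^sup>2"
  have D1: "\<bar>D\<bar> \<le> 1" using circle zero_le_power2[of \<alpha>] zero_le_power2[of \<beta>] unfolding D_def by linarith
  have D0: "\<bar>(A 0 - B 0) - D\<bar> \<le> 24 * \<epsilon>" using init(2,3) unfolding D_def by linarith
  have DD0: "\<bar>(A 0 - B 0)\<^sup>2 - D\<^sup>2\<bar> \<le> 72 * \<epsilon>"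
  proof -
    have "\<bar>(A 0 - B 0)\<^sup>2 - D\<^sup>2\<bar> = \<bar>(A 0 - B 0) + D\<bar> * \<bar>(A 0 - B 0) - D\<bar>"
      by (simp add: abs_mult[symmetric] power2_eq_square algebra_simps)
    also have "\<dots> \<le> 3 * (24 * \<epsilon>)"
      using D0 D1 \<epsilon> by (intro mult_mono) auto
    finally show ?thesis by simp
  qed
  show ?thesis
  proof (rule that[of A B])
    have "continuous_on UNIV (\<lambda>t. fourier_coef (\<omega> t) k)" for k
    proof -
      have "continuous_on UNIV (\<lambda>p. \<omega> (fst p) (snd p) * cas k (snd p))"
        using cW by (intro continuous_intros continuous_on_compose2[OF continuous_cas]) (auto simp: case_prod_unfold)
      from continuous_torus_integral_param[OF this] show ?thesis
        unfolding fourier_coef_def by (auto intro!: continuous_intros)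
    qed
    then show "continuous_on UNIV A" "continuous_on UNIV B"
      unfolding A_def B_def x_energy_def y_energy_def by (auto intro!: continuous_intros)
    show "torus_L2_dist (\<omega> t) (S1 \<alpha> \<beta>)
       \<le> 3 * \<epsilon> + 12 * (\<bar>sqrt (A t) - \<bar>\<alpha>\<bar>\<bar> + \<bar>sqrt (B t) - \<bar>\<beta>\<bar>\<bar>)" for t
    proof -
      have "sqrt 2 * N t \<le> 2 * N t" using N0 by (intro mult_right_mono real_le_lsqrt) auto
      then show ?thesis
        using torus_L2_dist_S1_le[OF c, of t \<alpha> \<beta>] Nle[of t] unfolding A_def B_def N_def by linarith
    qed
    show "\<bar>(A t - B t)\<^sup>2 - (\<alpha>\<^sup>2 - \<beta>\<^sup>2)\<^sup>2\<bar> \<le> 300 * \<epsilon>" for t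
    proof -
      \<comment> \<open>(A - B)^2 = (A + B)^2 - 4 A B turns sum and product into the square of the
        difference; the errors are 4 + 136 + 72 = 212 times \<epsilon>.\<close>
      have "(A t - B t)\<^sup>2 - (A 0 - B 0)\<^sup>2
         = ((A t + B t)\<^sup>2 - (A 0 + B 0)\<^sup>2) - 4 * (A t * B t - A 0 * B 0)"
        by (simp add: power2_eq_square algebra_simps)
      then show ?thesis
        using SS[of t] P[of t] DD0 \<epsilon> unfolding D_def[symmetric] right_diff_distrib by linarith
    qed
    show "\<bar>A t + B t - 1\<bar> \<le> 300 * \<epsilon>" for t using S[of t] \<epsilon> by linarith
    show "\<bar>(A 0 - B 0) - (\<alpha>\<^sup>2 - \<beta>\<^sup>2)\<bar> \<le> 300 * \<epsilon>"
      using D0 \<epsilon> unfolding D_def by linarith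
  qed (rule AB0)+
qed

text \<open>A - a^2 = (sqrt A - |a|)(sqrt A + |a|), and the second factor dominates both |a| and the
  modulus of the first. The first bound is linear but useful only for a nonzero; the second loses a
  square root and covers a = 0.\<close>

lemma abs_sqrt_diff_mult_le:
  assumes "0 \<le> A"
  shows "\<bar>sqrt A - \<bar>a\<bar>\<bar> * \<bar>a\<bar> \<le> \<bar>A - a\<^sup>2\<bar>" and "\<bar>sqrt A - \<bar>a\<bar>\<bar>\<^sup>2 \<le> \<bar>A - a\<^sup>2\<bar>"
proof -
  have "(sqrt A - \<bar>a\<bar>) * (sqrt A + \<bar>a\<bar>) = sqrt A * sqrt A - \<bar>a\<bar> * \<bar>a\<bar>"
    by (simp add: algebra_simps)
  also have "\<dots> = A - a\<^sup>2" using assms by (simp add: power2_eq_square)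
  finally have eq: "\<bar>A - a\<^sup>2\<bar> = \<bar>sqrt A - \<bar>a\<bar>\<bar> * (sqrt A + \<bar>a\<bar>)"
    using assms by (metis abs_ge_zero abs_mult abs_of_nonneg add_nonneg_nonneg real_sqrt_ge_zero)
  show "\<bar>sqrt A - \<bar>a\<bar>\<bar> * \<bar>a\<bar> \<le> \<bar>A - a\<^sup>2\<bar>"
    unfolding eq using assms by (intro mult_left_mono) auto
  have "\<bar>sqrt A - \<bar>a\<bar>\<bar> \<le> sqrt A + \<bar>a\<bar>" using assms real_sqrt_ge_zero[OF assms] by linarith
  then show "\<bar>sqrt A - \<bar>a\<bar>\<bar>\<^sup>2 \<le> \<bar>A - a\<^sup>2\<bar>"
    unfolding eq power2_eq_square[of "\<bar>sqrt A - \<bar>a\<bar>\<bar>"] by (intro mult_left_mono) auto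
qed

text \<open>
  The conserved quantities only determine the square of \<open>D t\<close>; by continuity in time
  \<open>D t\<close> stays in the component of its initial value.
\<close>

lemma continuous_branch:
  fixes D :: "real \<Rightarrow> real"
  assumes D: "continuous_on UNIV D" and sq: "\<And>t. \<bar>(D t)\<^sup>2 - b\<^sup>2\<bar> \<le> e" and D0: "\<bar>D 0 - b\<bar> \<le> e"
    and e: "e < b\<^sup>2" and b: "\<bar>b\<bar> \<le> 1"
  shows "\<bar>D t - b\<bar> \<le> e / \<bar>b\<bar>"
proof -
  have b2: "b\<^sup>2 \<le> \<bar>b\<bar>" using b by (metis abs_ge_zero mult_left_le power2_abs power2_eq_square)
  have e0: "0 \<le> e" using sq[of 0] by linarith
  then have bn: "b \<noteq> 0" using e by auto
  have nz: "D s * b \<noteq> 0" for s using sq[of s] e bn by auto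
  have pos0: "0 < D 0 * b"
  proof (cases "0 < b")
    case True
    then show ?thesis using D0 e b2 by (intro mult_pos_pos) auto
  next
    case False
    then show ?thesis using D0 e b2 bn by (intro mult_neg_neg) auto
  qed
  have pos: "0 < D t * b"
  proof (rule ccontr)
    assume "\<not> 0 < D t * b"
    moreover have "connected (range (\<lambda>s. D s * b))"
      using D by (intro connected_continuous_image continuous_intros) auto
    ultimately have "0 \<in> range (\<lambda>s. D s * b)"
      using pos0 connectedD_interval[of "range (\<lambda>s. D s * b)" "D t * b" "D 0 * b" 0] by auto
    then show False using nz by force
  qed
  \<comment> \<open>Equal signs give |D t + b| \<ge> |b|, so the bound on the difference of squares
    can be divided by |b|.\<close>
  then have "\<bar>D t + b\<bar> = \<bar>D t\<bar> + \<bar>b\<bar>" by (auto simp: zero_less_mult_iff)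
  then have "\<bar>D t - b\<bar> * \<bar>b\<bar> \<le> \<bar>D t - b\<bar> * \<bar>D t + b\<bar>" by (intro mult_left_mono) auto
  also have "\<dots> = \<bar>(D t)\<^sup>2 - b\<^sup>2\<bar>"
    by (simp add: abs_mult[symmetric] power2_eq_square algebra_simps)
  also have "\<dots> \<le> e" by (rule sq)
  finally show ?thesis using bn by (simp add: field_simps)
qed

text \<open>Common to the linear rate and to the points with \<alpha> = 0 or \<beta> = 0: these
  differ only in the passage from squared amplitudes to amplitudes.\<close>

lemma euler_distance_nondegenerate:
  fixes \<alpha> \<beta> :: real
  assumes circle: "\<alpha>\<^sup>2 + \<beta>\<^sup>2 = 1" and ne: "\<alpha>\<^sup>2 \<noteq> \<beta>\<^sup>2"
  obtains L \<epsilon>\<^sub>0 where "0 < L" "0 < \<epsilon>\<^sub>0" "\<epsilon>\<^sub>0 \<le> 1"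
    "\<And>\<epsilon> \<omega> t. 0 < \<epsilon> \<Longrightarrow> \<epsilon> < \<epsilon>\<^sub>0 \<Longrightarrow> smooth_euler_solution \<omega> \<Longrightarrow> torus_L2_dist (\<omega> 0) (S1 \<alpha> \<beta>) < \<epsilon> \<Longrightarrow>
      \<exists>A B. 0 \<le> A \<and> 0 \<le> B \<and> \<bar>A - \<alpha>\<^sup>2\<bar> \<le> L * \<epsilon> \<and> \<bar>B - \<beta>\<^sup>2\<bar> \<le> L * \<epsilon> \<and>
        torus_L2_dist (\<omega> t) (S1 \<alpha> \<beta>) \<le> 3 * \<epsilon> + 12 * (\<bar>sqrt A - \<bar>\<alpha>\<bar>\<bar> + \<bar>sqrt B - \<bar>\<beta>\<bar>\<bar>)"
proof -
  define b where "b = \<alpha>\<^sup>2 - \<beta>\<^sup>2"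
  have b: "b \<noteq> 0" "\<bar>b\<bar> \<le> 1"
    using ne circle zero_le_power2[of \<alpha>] zero_le_power2[of \<beta>] unfolding b_def by linarith+
  have b2: "0 < b\<^sup>2" "b\<^sup>2 \<le> 1" using b by (auto simp: abs_square_le_1)
  have inv: "1 \<le> 1 / \<bar>b\<bar>" using b by (simp add: field_simps)
  show ?thesis
  \<comment> \<open>\<open>continuous_branch\<close> with e = 300 \<epsilon> requires 300 \<epsilon>
    < b^2 and returns the error 300 \<epsilon> / |b|.\<close>
  proof (rule that[of "300 / \<bar>b\<bar>" "b\<^sup>2 / 300"])
    fix \<epsilon> \<omega> and t :: real
    assume \<epsilon>: "0 < \<epsilon>" "\<epsilon> < b\<^sup>2 / 300" and \<omega>: "smooth_euler_solution \<omega>"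
      and d: "torus_L2_dist (\<omega> 0) (S1 \<alpha> \<beta>) < \<epsilon>"
    have \<epsilon>1: "\<epsilon> < 1 / 300" using \<epsilon> b2 by linarith
    obtain A B where c: "continuous_on UNIV A" "continuous_on UNIV B"
      and AB: "\<And>t :: real. 0 \<le> A t" "\<And>t :: real. 0 \<le> B t"
      and S: "\<And>t. \<bar>A t + B t - 1\<bar> \<le> 300 * \<epsilon>"
      and D: "\<And>t. \<bar>(A t - B t)\<^sup>2 - b\<^sup>2\<bar> \<le> 300 * \<epsilon>" "\<bar>(A 0 - B 0) - b\<bar> \<le> 300 * \<epsilon>"
      and dist: "\<And>t. torus_L2_dist (\<omega> t) (S1 \<alpha> \<beta>)
         \<le> 3 * \<epsilon> + 12 * (\<bar>sqrt (A t) - \<bar>\<alpha>\<bar>\<bar> + \<bar>sqrt (B t) - \<bar>\<beta>\<bar>\<bar>)"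
      using euler_amplitudes[OF \<omega> circle \<epsilon>(1) \<epsilon>1 d] unfolding b_def by metis
    have "\<bar>(A t - B t) - b\<bar> \<le> 300 * \<epsilon> / \<bar>b\<bar>"
      by (rule continuous_branch[of "\<lambda>t. A t - B t"]) (use c D \<epsilon> b in \<open>auto intro!: continuous_intros\<close>)
    moreover have "300 * \<epsilon> \<le> 300 * \<epsilon> / \<bar>b\<bar>"
      using mult_left_mono[OF inv, of "300 * \<epsilon>"] \<epsilon> by simp
    moreover have "2 * (A t - \<alpha>\<^sup>2) = (A t + B t - 1) + ((A t - B t) - b)"
      "2 * (B t - \<beta>\<^sup>2) = (A t + B t - 1) - ((A t - B t) - b)"
      unfolding b_def using circle by (simp_all add: algebra_simps)
    ultimately have "\<bar>A t - \<alpha>\<^sup>2\<bar> \<le> 300 * \<epsilon> / \<bar>b\<bar>" "\<bar>B t - \<beta>\<^sup>2\<bar> \<le> 300 * \<epsilon> / \<bar>b\<bar>"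
      using S[of t] unfolding distrib_left right_diff_distrib by linarith+
    then show "\<exists>A B. 0 \<le> A \<and> 0 \<le> B \<and> \<bar>A - \<alpha>\<^sup>2\<bar> \<le> 300 / \<bar>b\<bar> * \<epsilon> \<and> \<bar>B - \<beta>\<^sup>2\<bar> \<le> 300 / \<bar>b\<bar> * \<epsilon> \<and>
        torus_L2_dist (\<omega> t) (S1 \<alpha> \<beta>) \<le> 3 * \<epsilon> + 12 * (\<bar>sqrt A - \<bar>\<alpha>\<bar>\<bar> + \<bar>sqrt B - \<bar>\<beta>\<bar>\<bar>)"
      using AB dist[of t] by (intro exI[of _ "A t"] exI[of _ "B t"]) auto
  qed (use b b2 in auto)
qed

section \<open>Stability at the two rates\<close>

definition orbitally_stable :: "real \<Rightarrow> real \<Rightarrow> (real \<Rightarrow> real) \<Rightarrow> bool"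
  where "orbitally_stable \<alpha> \<beta> \<phi> \<longleftrightarrow>
    (\<exists>C>0. \<exists>\<epsilon>\<^sub>0>0. \<forall>\<epsilon>::real. 0 < \<epsilon> \<and> \<epsilon> < \<epsilon>\<^sub>0 \<longrightarrow>
      (\<forall>\<omega>. smooth_euler_solution \<omega> \<longrightarrow> torus_L2_dist (\<omega> 0) (S1 \<alpha> \<beta>) < \<epsilon> \<longrightarrow>
        (\<forall>t. torus_L2_dist (\<omega> t) (S1 \<alpha> \<beta>) < C * \<phi> \<epsilon>)))"

lemma orbitally_stable_linear:
  assumes circle: "\<alpha>\<^sup>2 + \<beta>\<^sup>2 = 1" and ne: "\<alpha>\<^sup>2 \<noteq> \<beta>\<^sup>2" "\<alpha> \<noteq> 0" "\<beta> \<noteq> 0"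
  shows "orbitally_stable \<alpha> \<beta> (\<lambda>\<epsilon>. \<epsilon>)"
proof -
  obtain L \<epsilon>\<^sub>0 where L: "0 < L" "0 < \<epsilon>\<^sub>0" and
    AB: "\<And>\<epsilon> \<omega> t. 0 < \<epsilon> \<Longrightarrow> \<epsilon> < \<epsilon>\<^sub>0 \<Longrightarrow> smooth_euler_solution \<omega> \<Longrightarrow> torus_L2_dist (\<omega> 0) (S1 \<alpha> \<beta>) < \<epsilon> \<Longrightarrow>
      \<exists>A B. 0 \<le> A \<and> 0 \<le> B \<and> \<bar>A - \<alpha>\<^sup>2\<bar> \<le> L * \<epsilon> \<and> \<bar>B - \<beta>\<^sup>2\<bar> \<le> L * \<epsilon> \<and>
        torus_L2_dist (\<omega> t) (S1 \<alpha> \<beta>) \<le> 3 * \<epsilon> + 12 * (\<bar>sqrt A - \<bar>\<alpha>\<bar>\<bar> + \<bar>sqrt B - \<bar>\<beta>\<bar>\<bar>)"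
    using euler_distance_nondegenerate[OF circle ne(1)] by metis
  \<comment> \<open>The summand 4 exceeds the 3 of the distance bound in order to make the final
    inequality strict.\<close>
  define C where "C = 4 + 12 * (L / \<bar>\<alpha>\<bar> + L / \<bar>\<beta>\<bar>)"
  have C: "0 < C" unfolding C_def using L by (intro add_pos_nonneg) auto
  have "torus_L2_dist (\<omega> t) (S1 \<alpha> \<beta>) < C * \<epsilon>"
    if sol: "0 < \<epsilon>" "\<epsilon> < \<epsilon>\<^sub>0" "smooth_euler_solution \<omega>" "torus_L2_dist (\<omega> 0) (S1 \<alpha> \<beta>) < \<epsilon>" for \<epsilon> \<omega> t
  proof -
    obtain A B where "0 \<le> A" "0 \<le> B" and le: "\<bar>A - \<alpha>\<^sup>2\<bar> \<le> L * \<epsilon>" "\<bar>B - \<beta>\<^sup>2\<bar> \<le> L * \<epsilon>"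
      and d: "torus_L2_dist (\<omega> t) (S1 \<alpha> \<beta>) \<le> 3 * \<epsilon> + 12 * (\<bar>sqrt A - \<bar>\<alpha>\<bar>\<bar> + \<bar>sqrt B - \<bar>\<beta>\<bar>\<bar>)"
      using AB[OF sol, of t] by blast
    have "\<bar>sqrt A - \<bar>\<alpha>\<bar>\<bar> * \<bar>\<alpha>\<bar> \<le> L * \<epsilon>" "\<bar>sqrt B - \<bar>\<beta>\<bar>\<bar> * \<bar>\<beta>\<bar> \<le> L * \<epsilon>"
      using abs_sqrt_diff_mult_le(1)[OF \<open>0 \<le> A\<close>, of \<alpha>] abs_sqrt_diff_mult_le(1)[OF \<open>0 \<le> B\<close>, of \<beta>] le
      by linarith+
    then have "\<bar>sqrt A - \<bar>\<alpha>\<bar>\<bar> \<le> L / \<bar>\<alpha>\<bar> * \<epsilon>" "\<bar>sqrt B - \<bar>\<beta>\<bar>\<bar> \<le> L / \<bar>\<beta>\<bar> * \<epsilon>"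
      using ne by (simp_all add: field_simps)
    then have "torus_L2_dist (\<omega> t) (S1 \<alpha> \<beta>) \<le> 3 * \<epsilon> + 12 * (L / \<bar>\<alpha>\<bar> * \<epsilon> + L / \<bar>\<beta>\<bar> * \<epsilon>)"
      using d unfolding distrib_left by linarith
    also have "\<dots> < C * \<epsilon>" using \<open>0 < \<epsilon>\<close> by (simp add: C_def algebra_simps)
    finally show ?thesis .
  qed
  then show ?thesis unfolding orbitally_stable_def using C L(2) by blast
qed

text \<open>The square root is lost at one of two places. If the squares of \<alpha> and \<beta>
  differ, it is lost from squared amplitudes to amplitudes. If they agree, |A - B| is only of order
  sqrt \<epsilon>, but |\<alpha>| and |\<beta>| are at least 1/2 and the passage to amplitudes is
  linear.\<close>

lemma orbitally_stable_sqrt: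
  assumes circle: "\<alpha>\<^sup>2 + \<beta>\<^sup>2 = 1"
  shows "orbitally_stable \<alpha> \<beta> sqrt"
proof (cases "\<alpha>\<^sup>2 = \<beta>\<^sup>2")
  case False
  obtain L \<epsilon>\<^sub>0 where L: "0 < L" "0 < \<epsilon>\<^sub>0" "\<epsilon>\<^sub>0 \<le> 1" and
    AB: "\<And>\<epsilon> \<omega> t. 0 < \<epsilon> \<Longrightarrow> \<epsilon> < \<epsilon>\<^sub>0 \<Longrightarrow> smooth_euler_solution \<omega> \<Longrightarrow> torus_L2_dist (\<omega> 0) (S1 \<alpha> \<beta>) < \<epsilon> \<Longrightarrow>
      \<exists>A B. 0 \<le> A \<and> 0 \<le> B \<and> \<bar>A - \<alpha>\<^sup>2\<bar> \<le> L * \<epsilon> \<and> \<bar>B - \<beta>\<^sup>2\<bar> \<le> L * \<epsilon> \<and>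
        torus_L2_dist (\<omega> t) (S1 \<alpha> \<beta>) \<le> 3 * \<epsilon> + 12 * (\<bar>sqrt A - \<bar>\<alpha>\<bar>\<bar> + \<bar>sqrt B - \<bar>\<beta>\<bar>\<bar>)"
    using euler_distance_nondegenerate[OF circle False] by metis
  define C where "C = 4 + 24 * sqrt L"
  have C: "0 < C" unfolding C_def using L by (intro add_pos_nonneg) auto
  have "torus_L2_dist (\<omega> t) (S1 \<alpha> \<beta>) < C * sqrt \<epsilon>"
    if sol: "0 < \<epsilon>" "\<epsilon> < \<epsilon>\<^sub>0" "smooth_euler_solution \<omega>" "torus_L2_dist (\<omega> 0) (S1 \<alpha> \<beta>) < \<epsilon>" for \<epsilon> \<omega> t
  proof -
    obtain A B where "0 \<le> A" "0 \<le> B" and le: "\<bar>A - \<alpha>\<^sup>2\<bar> \<le> L * \<epsilon>" "\<bar>B - \<beta>\<^sup>2\<bar> \<le> L * \<epsilon>"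
      and d: "torus_L2_dist (\<omega> t) (S1 \<alpha> \<beta>) \<le> 3 * \<epsilon> + 12 * (\<bar>sqrt A - \<bar>\<alpha>\<bar>\<bar> + \<bar>sqrt B - \<bar>\<beta>\<bar>\<bar>)"
      using AB[OF sol, of t] by blast
    have "\<bar>sqrt A - \<bar>\<alpha>\<bar>\<bar>\<^sup>2 \<le> L * \<epsilon>" "\<bar>sqrt B - \<bar>\<beta>\<bar>\<bar>\<^sup>2 \<le> L * \<epsilon>"
      using abs_sqrt_diff_mult_le(2)[OF \<open>0 \<le> A\<close>, of \<alpha>] abs_sqrt_diff_mult_le(2)[OF \<open>0 \<le> B\<close>, of \<beta>] le
      by linarith+
    then have "\<bar>sqrt A - \<bar>\<alpha>\<bar>\<bar> \<le> sqrt (L * \<epsilon>)" "\<bar>sqrt B - \<bar>\<beta>\<bar>\<bar> \<le> sqrt (L * \<epsilon>)"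
      by (auto intro: real_le_rsqrt)
    moreover have "\<epsilon> \<le> sqrt \<epsilon>"
      using sol L(3) by (intro real_le_rsqrt) (simp add: power2_eq_square mult_left_le_one_le)
    ultimately have "torus_L2_dist (\<omega> t) (S1 \<alpha> \<beta>) \<le> 3 * sqrt \<epsilon> + (12 * sqrt (L * \<epsilon>) + 12 * sqrt (L * \<epsilon>))"
      using d unfolding distrib_left by (elim order.trans) (intro add_mono mult_left_mono; simp)
    also have "\<dots> < C * sqrt \<epsilon>" using \<open>0 < \<epsilon>\<close> by (simp add: C_def real_sqrt_mult algebra_simps)
    finally show ?thesis .
  qed
  then show ?thesis unfolding orbitally_stable_def using C L(2) by blast
next
  case True
  then have half: "\<alpha>\<^sup>2 = 1 / 2" "\<beta>\<^sup>2 = 1 / 2" using circle by auto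
  have "1 / 2 \<le> \<bar>x\<bar>" if "x\<^sup>2 = 1 / 2" for x :: real
    by (rule power2_le_imp_le) (use that in \<open>simp_all add: power_divide\<close>)
  then have ge: "1 / 2 \<le> \<bar>\<alpha>\<bar>" "1 / 2 \<le> \<bar>\<beta>\<bar>" using half by auto
  have "torus_L2_dist (\<omega> t) (S1 \<alpha> \<beta>) < 10000 * sqrt \<epsilon>"
    if \<epsilon>: "0 < \<epsilon>" "\<epsilon> < 1 / 300" and \<omega>: "smooth_euler_solution \<omega>" "torus_L2_dist (\<omega> 0) (S1 \<alpha> \<beta>) < \<epsilon>"
    for \<epsilon> \<omega> t
  proof -
    obtain A B where AB: "\<And>t :: real. 0 \<le> A t" "\<And>t :: real. 0 \<le> B t"
      and S: "\<And>t. \<bar>A t + B t - 1\<bar> \<le> 300 * \<epsilon>"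
      and D: "\<And>t. \<bar>(A t - B t)\<^sup>2 - (\<alpha>\<^sup>2 - \<beta>\<^sup>2)\<^sup>2\<bar> \<le> 300 * \<epsilon>"
      and d: "\<And>t. torus_L2_dist (\<omega> t) (S1 \<alpha> \<beta>)
         \<le> 3 * \<epsilon> + 12 * (\<bar>sqrt (A t) - \<bar>\<alpha>\<bar>\<bar> + \<bar>sqrt (B t) - \<bar>\<beta>\<bar>\<bar>)"
      using euler_amplitudes[OF \<omega>(1) circle \<epsilon> \<omega>(2)] by metis
    have e: "\<epsilon> \<le> sqrt \<epsilon>"
      using \<epsilon> by (intro real_le_rsqrt) (simp add: power2_eq_square mult_left_le_one_le)
    \<comment> \<open>18^2 = 324 exceeds 300; half of 300 + 18 is then below the 160 that
      follows.\<close>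
    have "\<bar>A t - B t\<bar> \<le> 18 * sqrt \<epsilon>"
    proof (rule power2_le_imp_le)
      show "\<bar>A t - B t\<bar>\<^sup>2 \<le> (18 * sqrt \<epsilon>)\<^sup>2"
        using D[of t] \<epsilon> by (simp add: half power_mult_distrib)
    qed (use \<epsilon> in simp)
    then have "\<bar>A t - \<alpha>\<^sup>2\<bar> \<le> 160 * sqrt \<epsilon>" "\<bar>B t - \<beta>\<^sup>2\<bar> \<le> 160 * sqrt \<epsilon>"
      using S[of t] e unfolding half by linarith+
    then have "\<bar>sqrt (A t) - \<bar>\<alpha>\<bar>\<bar> * \<bar>\<alpha>\<bar> \<le> 160 * sqrt \<epsilon>" "\<bar>sqrt (B t) - \<bar>\<beta>\<bar>\<bar> * \<bar>\<beta>\<bar> \<le> 160 * sqrt \<epsilon>"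
      using abs_sqrt_diff_mult_le(1)[OF AB(1), of t \<alpha>] abs_sqrt_diff_mult_le(1)[OF AB(2), of t \<beta>] by linarith+
    moreover have "\<bar>sqrt (A t) - \<bar>\<alpha>\<bar>\<bar> * (1 / 2) \<le> \<bar>sqrt (A t) - \<bar>\<alpha>\<bar>\<bar> * \<bar>\<alpha>\<bar>"
      "\<bar>sqrt (B t) - \<bar>\<beta>\<bar>\<bar> * (1 / 2) \<le> \<bar>sqrt (B t) - \<bar>\<beta>\<bar>\<bar> * \<bar>\<beta>\<bar>"
      using ge by (intro mult_left_mono; simp)+
    \<comment> \<open>Each amplitude is off by at most 320 sqrt \<epsilon>, and 3 + 12 * 640 =
      7683.\<close>
    ultimately have "torus_L2_dist (\<omega> t) (S1 \<alpha> \<beta>) \<le> 7683 * sqrt \<epsilon>"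
      using d[of t] e unfolding distrib_left by linarith
    also have "\<dots> < 10000 * sqrt \<epsilon>" using \<epsilon> by simp
    finally show ?thesis .
  qed
  then show ?thesis
    unfolding orbitally_stable_def
    by (intro exI[of _ "10000 :: real"] exI[of _ "1 / 300 :: real"] conjI) auto
qed

text \<open>On the circle the exceptional points are the zeros of \<alpha> \<beta> (\<alpha>^2 -
  \<beta>^2), that is, the points where one of the square roots is lost.\<close>

lemma not_exceptional:
  assumes circle: "\<alpha>\<^sup>2 + \<beta>\<^sup>2 = 1" and "(\<alpha>, \<beta>) \<notin> exceptional_points"
  shows "\<alpha>\<^sup>2 \<noteq> \<beta>\<^sup>2" "\<alpha> \<noteq> 0" "\<beta> \<noteq> 0"
proof -
  show "\<alpha> \<noteq> 0" "\<beta> \<noteq> 0"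
    using assms by (auto simp: exceptional_points_def power2_eq_1_iff)
  show "\<alpha>\<^sup>2 \<noteq> \<beta>\<^sup>2"
  proof
    assume "\<alpha>\<^sup>2 = \<beta>\<^sup>2"
    then have "\<alpha>\<^sup>2 = (1 / sqrt 2)\<^sup>2" "\<beta>\<^sup>2 = (1 / sqrt 2)\<^sup>2"
      using circle by (auto simp: power_divide)
    then have "\<alpha> = 1 / sqrt 2 \<or> \<alpha> = - 1 / sqrt 2" "\<beta> = 1 / sqrt 2 \<or> \<beta> = - 1 / sqrt 2"
      unfolding power2_eq_iff by auto
    then show False using assms(2) unfolding exceptional_points_def by blast
  qed
qed

theorem theorem1p3:
  fixes \<alpha> \<beta> :: real
  assumes "\<alpha>\<^sup>2 + \<beta>\<^sup>2 = 1"
  shows "((\<alpha>, \<beta>) \<in> exceptional_points \<longrightarrow>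
           (\<exists>C>0. \<exists>\<epsilon>\<^sub>0>0. \<forall>\<epsilon>::real. 0 < \<epsilon> \<and> \<epsilon> < \<epsilon>\<^sub>0 \<longrightarrow>
             (\<forall>\<omega>. smooth_euler_solution \<omega> \<longrightarrow>
               torus_L2_dist (\<omega> 0) (S1 \<alpha> \<beta>) < \<epsilon> \<longrightarrow>
               (\<forall>t. torus_L2_dist (\<omega> t) (S1 \<alpha> \<beta>) < C * sqrt \<epsilon>)))) \<and>
         ((\<alpha>, \<beta>) \<notin> exceptional_points \<longrightarrow>
           (\<exists>C>0. \<exists>\<epsilon>\<^sub>0>0. \<forall>\<epsilon>::real. 0 < \<epsilon> \<and> \<epsilon> < \<epsilon>\<^sub>0 \<longrightarrow>
             (\<forall>\<omega>. smooth_euler_solution \<omega> \<longrightarrow>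
               torus_L2_dist (\<omega> 0) (S1 \<alpha> \<beta>) < \<epsilon> \<longrightarrow>
               (\<forall>t. torus_L2_dist (\<omega> t) (S1 \<alpha> \<beta>) < C * \<epsilon>))))"
  using orbitally_stable_sqrt[OF assms] orbitally_stable_linear[OF assms not_exceptional[OF assms]]
  unfolding orbitally_stable_def by blast

end
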